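(* Let $E$ be a Banach lattice. For any $f\in E^\sim_n$, the following conditions are equivalent: (1) $f\in E^\sim_{uo}$; (2) $f(x_n)\to0$ for any norm bounded $uo$-null sequence $(x_n)$ in $E$; (3) $f\in E^\sim_{uaw}$; (4) $f(x_n)\to0$ for any norm bounded $uaw$-null sequence $(x_n)$ in $E$; (5) $f\in E^\sim_{d}$; (6) $f(x_n)\to0$ for any norm bounded disjoint sequence $(x_n)$ in $E$; (7) every disjoint sequence in $[0,|f|]$ is norm convergent to zero. In addition, if $E$ has order continuous norm, these conditions are equivalent to each of: (8) $f\in E^\sim_{un}$; (9) $f(x_n)\to0$ for any norm bounded $un$-null sequence $(x_n)$ in $E$.
   Context: Order convergence: a net $(x_\alpha)$ in a Riesz space is order convergent to $x$ if there is a net $(y_\beta)$, possibly over a different index set, with $y_\beta\downarrow 0$ such that for each $\beta$ there is $\alpha_0$ with $|x_\alpha-x|\le y_\beta$ for all $\alpha\ge\alpha_0$. A net $(x_\alpha)$ is disjoint if $|x_\alpha|\wedge|x_\beta|=0$ whenever $\alpha\neq\beta$. A net $(x_\alpha)$ in a Banach lattice $E$ is $uo$-null (resp. $un$-null, $uaw$-null) if for every $u\in E_+$ the net $(|x_\alpha|\wedge u)$ converges to $0$ in order (resp. in norm, weakly). Duals: $E^\sim_n$ is the set of all order continuous linear functionals on $E$, i.e. those $f$ with $f(x_\alpha)\to0$ for every net $(x_\alpha)$ order converging to $0$. $E^\sim_{uo}$ is the set of linear functionals $f$ on $E$ with $f(x_\alpha)\to0$ for every norm bounded $uo$-null net in $E$.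 $E^\sim_d$ (resp. $E^\sim_{un}$, $E^\sim_{uaw}$) is the set of norm bounded linear functionals $f$ on $E$ with $f(x_\alpha)\to0$ for every norm bounded disjoint (resp. $un$-null, $uaw$-null) net $(x_\alpha)$ in $E$. A Banach lattice has order continuous norm if $\|x_\alpha\|\to0$ for every net $x_\alpha\downarrow0$.
   Formalization: In (5), disjoint nets are taken only over directed index sets without a greatest element; otherwise one-point nets are vacuously disjoint, E_d^~ would be {0}, and the equivalence fails (e.g. E = ℝ, f the identity). *)

theory Defs
  imports "HOL-Analysis.Analysis" "HOL-Library.Lattice_Algebras"
begin

section \<open>Banach lattices\<close>

class banach_lattice = banach + ordered_real_vector + lattice_ab_group_add_abs +
  assumes norm_abs_mono: "\<bar>x\<bar> \<le> \<bar>y\<bar> \<Longrightarrow> norm x \<le> norm y"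

instance real :: banach_lattice
  by standard auto


section \<open>Nets\<close>

text \<open>
  A net is a function on an explicit index set \<open>I\<close>, directed upwards by a preorder \<open>le\<close>.
  Limits along it are limits along the filter \<open>tails I le\<close> generated by the sets
  \<open>{j \<in> I. le i j}\<close>; for the sequence index set \<open>(UNIV, \<le>)\<close> this is \<open>sequentially\<close>.
\<close>

definition directed_set :: "'i set \<Rightarrow> ('i \<Rightarrow> 'i \<Rightarrow> bool) \<Rightarrow> bool" where
  "directed_set I le \<longleftrightarrow>
     I \<noteq> {} \<and>
     (\<forall>i\<in>I. le i i) \<and>
     (\<forall>i\<in>I. \<forall>j\<in>I. \<forall>k\<in>I. le i j \<longrightarrow> le j k \<longrightarrow> le i k) \<and>
     (\<forall>i\<in>I. \<forall>j\<in>I. \<exists>k\<in>I. le i k \<and> le j k)"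

definition tails :: "'i set \<Rightarrow> ('i \<Rightarrow> 'i \<Rightarrow> bool) \<Rightarrow> 'i filter" where
  "tails I le = (INF i\<in>I. principal {j\<in>I. le i j})"

lemma eventually_tails:
  assumes "directed_set I le"
  shows "eventually P (tails I le) \<longleftrightarrow> (\<exists>i\<in>I. \<forall>j\<in>I. le i j \<longrightarrow> P j)"
proof -
  have "eventually P (tails I le) \<longleftrightarrow> (\<exists>i\<in>I. eventually P (principal {j\<in>I. le i j}))"
    unfolding tails_def
  proof (rule eventually_INF_base)
    show "I \<noteq> {}" using assms by (simp add: directed_set_def)
    fix a b assume ab: "a \<in> I" "b \<in> I"
    then obtain k where "k \<in> I" "le a k" "le b k"
      using assms unfolding directed_set_def by meson
    with ab have "{j\<in>I. le k j} \<subseteq> {j\<in>I. le a j} \<inter> {j\<in>I. le b j}"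
      using assms unfolding directed_set_def by blast
    with \<open>k \<in> I\<close> show "\<exists>x\<in>I. principal {j\<in>I. le x j}
        \<le> inf (principal {j\<in>I. le a j}) (principal {j\<in>I. le b j})"
      by (intro bexI[of _ k]) (auto simp: le_principal eventually_principal)
  qed
  then show ?thesis unfolding eventually_principal by blast
qed

lemma eventually_tails_witness:
  assumes "directed_set I le" "eventually P (tails I le)"
  shows "\<exists>i\<in>I. P i"
proof -
  obtain i where "i \<in> I" "\<forall>j\<in>I. le i j \<longrightarrow> P j"
    using assms(2) unfolding eventually_tails[OF assms(1)] by blast
  moreover have "le i i" using assms(1) \<open>i \<in> I\<close> by (simp add: directed_set_def)
  ultimately show ?thesis by blast
qed

lemma directed_set_nat: "directed_set (UNIV :: nat set) (\<le>)"
proof -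
  have "\<exists>k. i \<le> k \<and> j \<le> k" for i j :: nat
    by (intro exI[of _ "max i j"]) simp
  then show ?thesis unfolding directed_set_def by simp
qed

lemma tails_nat: "tails (UNIV :: nat set) (\<le>) = sequentially"
  by (rule filter_eqI)
    (simp add: eventually_tails[OF directed_set_nat] eventually_sequentially)

text \<open>
  HOL cannot quantify over all index types inside a formula, so a quantification over
  ``all nets in \<open>'a\<close>'' ranges over the index sets inside the one type below.  This
  loses nothing: the lemmas named \<open>any_index\<close> show that each notion so defined
  has its defining property for nets over index sets of every type.
\<close>

type_synonym 'a net_index = "'a \<times> 'a set"

definition decreasing_to_zero ::
    "'i set \<Rightarrow> ('i \<Rightarrow> 'i \<Rightarrow> bool) \<Rightarrow> ('i \<Rightarrow> 'a::banach_lattice) \<Rightarrow> bool" where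
  "decreasing_to_zero I le y \<longleftrightarrow>
     (\<forall>i\<in>I. \<forall>j\<in>I. le i j \<longrightarrow> y j \<le> y i) \<and>
     (\<forall>i\<in>I. 0 \<le> y i) \<and>
     (\<forall>z. (\<forall>i\<in>I. z \<le> y i) \<longrightarrow> z \<le> 0)"

definition order_conv :: "('i \<Rightarrow> 'a::banach_lattice) \<Rightarrow> 'a \<Rightarrow> 'i filter \<Rightarrow> bool" where
  "order_conv x l F \<longleftrightarrow>
     (\<exists>J le (y :: 'a net_index \<Rightarrow> 'a).
        directed_set J le \<and> decreasing_to_zero J le y \<and>
        (\<forall>\<beta>\<in>J. eventually (\<lambda>\<alpha>. \<bar>x \<alpha> - l\<bar> \<le> y \<beta>) F))"

definition disjoint_on :: "'i set \<Rightarrow> ('i \<Rightarrow> 'a::banach_lattice) \<Rightarrow> bool" where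
  "disjoint_on I x \<longleftrightarrow> (\<forall>i\<in>I. \<forall>j\<in>I. i \<noteq> j \<longrightarrow> inf \<bar>x i\<bar> \<bar>x j\<bar> = 0)"

definition uo_null :: "('i \<Rightarrow> 'a::banach_lattice) \<Rightarrow> 'i filter \<Rightarrow> bool" where
  "uo_null x F \<longleftrightarrow> (\<forall>u\<ge>0. order_conv (\<lambda>\<alpha>. inf \<bar>x \<alpha>\<bar> u) 0 F)"

definition un_null :: "('i \<Rightarrow> 'a::banach_lattice) \<Rightarrow> 'i filter \<Rightarrow> bool" where
  "un_null x F \<longleftrightarrow> (\<forall>u\<ge>0. ((\<lambda>\<alpha>. inf \<bar>x \<alpha>\<bar> u) \<longlongrightarrow> 0) F)"

definition weakly_null :: "('i \<Rightarrow> 'a::banach_lattice) \<Rightarrow> 'i filter \<Rightarrow> bool" where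
  "weakly_null x F \<longleftrightarrow>
     (\<forall>g :: 'a \<Rightarrow> real. bounded_linear g \<longrightarrow> ((\<lambda>\<alpha>. g (x \<alpha>)) \<longlongrightarrow> 0) F)"

definition uaw_null :: "('i \<Rightarrow> 'a::banach_lattice) \<Rightarrow> 'i filter \<Rightarrow> bool" where
  "uaw_null x F \<longleftrightarrow> (\<forall>u\<ge>0. weakly_null (\<lambda>\<alpha>. inf \<bar>x \<alpha>\<bar> u) F)"


section \<open>Spaces of functionals\<close>

definition order_cont_dual :: "('a::banach_lattice \<Rightarrow> real) set" where
  "order_cont_dual = {f. linear f \<and>
     (\<forall>I le (x :: 'a net_index \<Rightarrow> 'a).
        directed_set I le \<longrightarrow> order_conv x 0 (tails I le) \<longrightarrow>
        ((\<lambda>\<alpha>. f (x \<alpha>)) \<longlongrightarrow> 0) (tails I le))}"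

definition uo_dual :: "('a::banach_lattice \<Rightarrow> real) set" where
  "uo_dual = {f. linear f \<and>
     (\<forall>I le (x :: 'a net_index \<Rightarrow> 'a).
        directed_set I le \<longrightarrow> bounded (x ` I) \<longrightarrow> uo_null x (tails I le) \<longrightarrow>
        ((\<lambda>\<alpha>. f (x \<alpha>)) \<longlongrightarrow> 0) (tails I le))}"

definition un_dual :: "('a::banach_lattice \<Rightarrow> real) set" where
  "un_dual = {f. bounded_linear f \<and>
     (\<forall>I le (x :: 'a net_index \<Rightarrow> 'a).
        directed_set I le \<longrightarrow> bounded (x ` I) \<longrightarrow> un_null x (tails I le) \<longrightarrow>
        ((\<lambda>\<alpha>. f (x \<alpha>)) \<longlongrightarrow> 0) (tails I le))}"

definition uaw_dual :: "('a::banach_lattice \<Rightarrow> real) set" where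
  "uaw_dual = {f. bounded_linear f \<and>
     (\<forall>I le (x :: 'a net_index \<Rightarrow> 'a).
        directed_set I le \<longrightarrow> bounded (x ` I) \<longrightarrow> uaw_null x (tails I le) \<longrightarrow>
        ((\<lambda>\<alpha>. f (x \<alpha>)) \<longlongrightarrow> 0) (tails I le))}"

text \<open>
  Index sets of disjoint nets must have no greatest element.  A one-point net is vacuously
  disjoint and converges to its only value, so admitting it would force \<open>f = 0\<close>.
\<close>

definition disjoint_dual :: "('a::banach_lattice \<Rightarrow> real) set" where
  "disjoint_dual = {f. bounded_linear f \<and>
     (\<forall>I le (x :: 'a net_index \<Rightarrow> 'a).
        directed_set I le \<longrightarrow> \<not> (\<exists>m\<in>I. \<forall>i\<in>I. le i m) \<longrightarrow>
        bounded (x ` I) \<longrightarrow> disjoint_on I x \<longrightarrow>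
        ((\<lambda>\<alpha>. f (x \<alpha>)) \<longlongrightarrow> 0) (tails I le))}"

definition order_continuous_norm :: "'a::banach_lattice itself \<Rightarrow> bool" where
  "order_continuous_norm _ \<longleftrightarrow>
     (\<forall>I le (x :: 'a net_index \<Rightarrow> 'a).
        directed_set I le \<longrightarrow> decreasing_to_zero I le x \<longrightarrow>
        ((\<lambda>\<alpha>. norm (x \<alpha>)) \<longlongrightarrow> 0) (tails I le))"


section \<open>The lattice structure of the dual\<close>

text \<open>
  The dual of a Banach lattice consists of the norm bounded (equivalently, order bounded)
  linear functionals; its order is the pointwise one on the positive cone.  The lattice
  operations are the order-theoretic ones (they exist by Riesz--Kantorovich).
\<close>

definition dual_le :: "('a::banach_lattice \<Rightarrow> real) \<Rightarrow> ('a \<Rightarrow> real) \<Rightarrow> bool" where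
  "dual_le g h \<longleftrightarrow> (\<forall>x\<ge>0. g x \<le> h x)"

definition is_dual_sup ::
    "('a::banach_lattice \<Rightarrow> real) \<Rightarrow> ('a \<Rightarrow> real) \<Rightarrow> ('a \<Rightarrow> real) \<Rightarrow> bool" where
  "is_dual_sup g h s \<longleftrightarrow> bounded_linear s \<and> dual_le g s \<and> dual_le h s \<and>
     (\<forall>t. bounded_linear t \<longrightarrow> dual_le g t \<longrightarrow> dual_le h t \<longrightarrow> dual_le s t)"

definition is_dual_inf ::
    "('a::banach_lattice \<Rightarrow> real) \<Rightarrow> ('a \<Rightarrow> real) \<Rightarrow> ('a \<Rightarrow> real) \<Rightarrow> bool" where
  "is_dual_inf g h s \<longleftrightarrow> bounded_linear s \<and> dual_le s g \<and> dual_le s h \<and>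
     (\<forall>t. bounded_linear t \<longrightarrow> dual_le t g \<longrightarrow> dual_le t h \<longrightarrow> dual_le t s)"

definition dual_abs :: "('a::banach_lattice \<Rightarrow> real) \<Rightarrow> ('a \<Rightarrow> real)" where
  "dual_abs f = (THE s. is_dual_sup f (\<lambda>x. - f x) s)"

definition dual_interval :: "('a::banach_lattice \<Rightarrow> real) \<Rightarrow> ('a \<Rightarrow> real) \<Rightarrow> ('a \<Rightarrow> real) set" where
  "dual_interval g h = {k. bounded_linear k \<and> dual_le g k \<and> dual_le k h}"

definition dual_disjoint_seq :: "(nat \<Rightarrow> 'a::banach_lattice \<Rightarrow> real) \<Rightarrow> bool" where
  "dual_disjoint_seq g \<longleftrightarrow>
     (\<forall>m n. m \<noteq> n \<longrightarrow> is_dual_inf (dual_abs (g m)) (dual_abs (g n)) (\<lambda>_. 0))"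


section \<open>Independence of the index type\<close>

lemma decreasing_to_zero_reindex:
  fixes y :: "'i \<Rightarrow> 'a::banach_lattice"
  assumes dir: "directed_set I le" and dec: "decreasing_to_zero I le y"
  obtains J le' and z :: "'a net_index \<Rightarrow> 'a"
  where "directed_set J le'" "decreasing_to_zero J le' z" "z ` J = y ` I"
    "\<And>p q. le' p q \<longleftrightarrow> z q \<le> z p"
proof
  let ?J = "(\<lambda>v. (v, {})) ` y ` I" and ?le = "\<lambda>p q :: 'a net_index. fst q \<le> fst p"
  show "directed_set ?J ?le"
    unfolding directed_set_def
  proof (intro conjI ballI impI)
    show "?J \<noteq> {}" using dir by (simp add: directed_set_def)
    fix p q assume "p \<in> ?J" "q \<in> ?J"
    then obtain i j where ij: "i \<in> I" "j \<in> I" "fst p = y i" "fst q = y j" by auto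
    then obtain k where k: "k \<in> I" "le i k" "le j k"
      using dir unfolding directed_set_def by meson
    then have "y k \<le> y i" "y k \<le> y j" using dec ij unfolding decreasing_to_zero_def by auto
    then show "\<exists>r\<in>?J. ?le p r \<and> ?le q r" using k ij by force
  qed auto
  show "decreasing_to_zero ?J ?le fst"
    using dec unfolding decreasing_to_zero_def by auto
  show "fst ` ?J = y ` I" by (simp add: image_image)
qed auto

lemma order_conv_any_index:
  fixes y :: "'j \<Rightarrow> 'a::banach_lattice"
  assumes "directed_set J le" "decreasing_to_zero J le y"
    and "\<And>\<beta>. \<beta> \<in> J \<Longrightarrow> eventually (\<lambda>\<alpha>. \<bar>x \<alpha> - l\<bar> \<le> y \<beta>) F"
  shows "order_conv x l F"
proof -
  obtain K le' and z :: "'a net_index \<Rightarrow> 'a" where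
    z: "directed_set K le'" "decreasing_to_zero K le' z" "z ` K = y ` J"
    using decreasing_to_zero_reindex[OF assms(1,2)] by metis
  have "eventually (\<lambda>\<alpha>. \<bar>x \<alpha> - l\<bar> \<le> z \<beta>) F" if "\<beta> \<in> K" for \<beta>
  proof -
    from that z(3) obtain j where "j \<in> J" "z \<beta> = y j" by (metis imageE imageI)
    then show ?thesis using assms(3) by simp
  qed
  with z show ?thesis unfolding order_conv_def by blast
qed

lemma order_continuous_norm_any_index:
  fixes y :: "'i \<Rightarrow> 'a::banach_lattice"
  assumes "order_continuous_norm TYPE('a)" "directed_set I le" "decreasing_to_zero I le y"
  shows "((\<lambda>\<alpha>. norm (y \<alpha>)) \<longlongrightarrow> 0) (tails I le)"
proof (rule tendstoI)
  fix e :: real assume e: "e > 0"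
  obtain K le' and z :: "'a net_index \<Rightarrow> 'a" where
    z: "directed_set K le'" "decreasing_to_zero K le' z" "z ` K = y ` I"
    using decreasing_to_zero_reindex[OF assms(2,3)] by metis
  then have "((\<lambda>\<alpha>. norm (z \<alpha>)) \<longlongrightarrow> 0) (tails K le')"
    using assms(1) unfolding order_continuous_norm_def by blast
  from eventually_tails_witness[OF z(1) tendstoD[OF this e]]
  obtain k where k: "k \<in> K" "norm (z k) < e" by auto
  then obtain i where i: "i \<in> I" "y i = z k" using z(3) by (metis imageE imageI)
  have "norm (y j) < e" if "j \<in> I" "le i j" for j
  proof -
    have "y j \<le> y i" "0 \<le> y j" "0 \<le> y i"
      using assms(3) i that unfolding decreasing_to_zero_def by auto
    then have "norm (y j) \<le> norm (y i)" by (intro norm_abs_mono) simp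
    with k i show ?thesis by simp
  qed
  then have "\<forall>j\<in>I. le i j \<longrightarrow> dist (norm (y j)) 0 < e" by simp
  with i(1) show "eventually (\<lambda>\<alpha>. dist (norm (y \<alpha>)) 0 < e) (tails I le)"
    unfolding eventually_tails[OF assms(2)] by (rule bexI[rotated])
qed

lemma net_reindex:
  fixes x :: "'i \<Rightarrow> 'a"
  assumes dir: "directed_set I le"
  obtains J le' and z :: "'a net_index \<Rightarrow> 'a"
  where "directed_set J le'" "z ` J = x ` I"
    "filtermap z (tails J le') = filtermap x (tails I le)"
proof
  let ?T = "\<lambda>i. x ` {j\<in>I. le i j}"
  let ?J = "\<Union>i\<in>I. ?T i \<times> {?T i}" and ?le = "\<lambda>p q :: 'a net_index. snd q \<subseteq> snd p"
  have refl: "le i i" if "i \<in> I" for i using dir that by (simp add: directed_set_def)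
  have anti: "?T k \<subseteq> ?T i" if "i \<in> I" "k \<in> I" "le i k" for i k
  proof -
    have "le i j" if "j \<in> I" "le k j" for j
      using dir \<open>i \<in> I\<close> \<open>k \<in> I\<close> \<open>le i k\<close> that unfolding directed_set_def by meson
    then show ?thesis by auto
  qed
  have mem: "(x j, ?T i) \<in> ?J" if "i \<in> I" "j \<in> I" "le i j" for i j
    using that by (intro UN_I[of i]) auto
  have elim: "\<exists>i\<in>I. \<exists>j\<in>I. le i j \<and> p = (x j, ?T i)" if "p \<in> ?J" for p
    using that by auto
  show *: "directed_set ?J ?le"
    unfolding directed_set_def
  proof (intro conjI ballI impI)
    obtain i where "i \<in> I" using dir by (auto simp: directed_set_def)
    then show "?J \<noteq> {}" using mem[of i i] refl by blast
    fix p q assume "p \<in> ?J" "q \<in> ?J"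
    then obtain i j where ij: "i \<in> I" "j \<in> I" "snd p = ?T i" "snd q = ?T j"
      using elim[of p] elim[of q] by auto
    then obtain k where k: "k \<in> I" "le i k" "le j k"
      using dir unfolding directed_set_def by meson
    have "(x k, ?T k) \<in> ?J" using mem[of k k] refl k(1) by simp
    moreover have "?le p (x k, ?T k)" "?le q (x k, ?T k)"
      using anti[of i k] anti[of j k] ij k by simp_all
    ultimately show "\<exists>r\<in>?J. ?le p r \<and> ?le q r" by (intro bexI[of _ "(x k, ?T k)"] conjI)
  qed auto
  show "fst ` ?J = x ` I"
  proof
    show "fst ` ?J \<subseteq> x ` I" by auto
    show "x ` I \<subseteq> fst ` ?J"
    proof
      fix v assume "v \<in> x ` I"
      then obtain i where "i \<in> I" "v = x i" by auto
      then show "v \<in> fst ` ?J" using imageI[OF mem[of i i], of fst] refl by simp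
    qed
  qed
  show "filtermap fst (tails ?J ?le) = filtermap x (tails I le)"
  proof (rule filter_eqI)
    fix P :: "'a \<Rightarrow> bool"
    have "(\<exists>p\<in>?J. \<forall>q\<in>?J. ?le p q \<longrightarrow> P (fst q)) \<longleftrightarrow> (\<exists>i\<in>I. \<forall>j\<in>I. le i j \<longrightarrow> P (x j))"
    proof
      assume "\<exists>p\<in>?J. \<forall>q\<in>?J. ?le p q \<longrightarrow> P (fst q)"
      then obtain p where p0: "p \<in> ?J" "\<forall>q\<in>?J. ?le p q \<longrightarrow> P (fst q)" by (rule bexE)
      from elim[OF p0(1)] obtain i where i: "i \<in> I" "snd p = ?T i" by auto
      have "P (x j)" if "j \<in> I" "le i j" for j
      proof -
        have "(x j, ?T i) \<in> ?J" using mem[OF i(1) that] .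
        from bspec[OF p0(2) this] i(2) show ?thesis by simp
      qed
      with i(1) show "\<exists>i\<in>I. \<forall>j\<in>I. le i j \<longrightarrow> P (x j)" by blast
    next
      assume "\<exists>i\<in>I. \<forall>j\<in>I. le i j \<longrightarrow> P (x j)"
      then obtain i where i: "i \<in> I" "\<forall>j\<in>I. le i j \<longrightarrow> P (x j)" by blast
      have "(x i, ?T i) \<in> ?J" using mem[of i i] i(1) refl by simp
      moreover have "\<forall>q\<in>?J. ?le (x i, ?T i) q \<longrightarrow> P (fst q)"
      proof (intro ballI impI)
        fix q assume "q \<in> ?J" and sub: "?le (x i, ?T i) q"
        from elim[OF this(1)] obtain k j where "j \<in> I" "le k j" "q = (x j, ?T k)" by auto
        then have "fst q \<in> snd q" by auto
        with sub have "fst q \<in> ?T i" by auto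
        with i(2) show "P (fst q)" by auto
      qed
      ultimately show "\<exists>p\<in>?J. \<forall>q\<in>?J. ?le p q \<longrightarrow> P (fst q)" by (rule bexI[rotated])
    qed
    then show "eventually P (filtermap fst (tails ?J ?le)) \<longleftrightarrow>
        eventually P (filtermap x (tails I le))"
      by (simp only: eventually_filtermap eventually_tails[OF *] eventually_tails[OF dir])
  qed
qed

lemma order_conv_filtermap:
  "order_conv (\<lambda>\<alpha>. h (x \<alpha>)) l F \<longleftrightarrow> order_conv h l (filtermap x F)"
  by (simp add: order_conv_def eventually_filtermap)

lemma tendsto_comp_filtermap:
  "((\<lambda>\<alpha>. h (x \<alpha>)) \<longlongrightarrow> l) F \<longleftrightarrow> (h \<longlongrightarrow> l) (filtermap x F)"
  by (simp add: filterlim_def filtermap_filtermap)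

lemma null_filtermap:
  "uo_null x F \<longleftrightarrow> uo_null (\<lambda>v. v) (filtermap x F)"
  "un_null x F \<longleftrightarrow> un_null (\<lambda>v. v) (filtermap x F)"
  "uaw_null x F \<longleftrightarrow> uaw_null (\<lambda>v. v) (filtermap x F)"
  by (simp_all add: uo_null_def un_null_def uaw_null_def weakly_null_def order_conv_def
      eventually_filtermap filterlim_def filtermap_filtermap)

lemma order_cont_dual_any_index:
  fixes x :: "'i \<Rightarrow> 'a::banach_lattice"
  assumes "f \<in> order_cont_dual" "directed_set I le" "order_conv x 0 (tails I le)"
  shows "((\<lambda>\<alpha>. f (x \<alpha>)) \<longlongrightarrow> 0) (tails I le)"
proof -
  obtain J le' and z :: "'a net_index \<Rightarrow> 'a" where z: "directed_set J le'"
    "filtermap z (tails J le') = filtermap x (tails I le)"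
    using net_reindex[OF assms(2), of x] by metis
  have "order_conv z 0 (tails J le')"
    using assms(3) order_conv_filtermap[of "\<lambda>v. v" x 0 "tails I le"]
      order_conv_filtermap[of "\<lambda>v. v" z 0 "tails J le'"] z(2) by simp
  with assms(1) z(1) have "((\<lambda>\<alpha>. f (z \<alpha>)) \<longlongrightarrow> 0) (tails J le')"
    unfolding order_cont_dual_def by blast
  then have "(f \<longlongrightarrow> 0) (filtermap x (tails I le))"
    unfolding tendsto_comp_filtermap[of f z 0 "tails J le'"] z(2) .
  then show ?thesis by (rule tendsto_comp_filtermap[THEN iffD2])
qed

lemma uo_un_uaw_dual_any_index:
  fixes x :: "'i \<Rightarrow> 'a::banach_lattice"
  assumes dir: "directed_set I le" and bdd: "bounded (x ` I)"
    and cases: "f \<in> uo_dual \<and> uo_null x (tails I le) \<or> f \<in> un_dual \<and> un_null x (tails I le)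
      \<or> f \<in> uaw_dual \<and> uaw_null x (tails I le)"
  shows "((\<lambda>\<alpha>. f (x \<alpha>)) \<longlongrightarrow> 0) (tails I le)"
proof -
  obtain J le' and z :: "'a net_index \<Rightarrow> 'a" where z: "directed_set J le'" "z ` J = x ` I"
    "filtermap z (tails J le') = filtermap x (tails I le)"
    using net_reindex[OF dir, of x] by metis
  have "f \<in> uo_dual \<and> uo_null z (tails J le') \<or> f \<in> un_dual \<and> un_null z (tails J le')
      \<or> f \<in> uaw_dual \<and> uaw_null z (tails J le')"
    using cases unfolding null_filtermap[of x] null_filtermap[of z] z(3) .
  moreover have "bounded (z ` J)" using bdd z(2) by simp
  ultimately have "((\<lambda>\<alpha>. f (z \<alpha>)) \<longlongrightarrow> 0) (tails J le')"
    using z(1) unfolding uo_dual_def un_dual_def uaw_dual_def by blast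
  then have "(f \<longlongrightarrow> 0) (filtermap x (tails I le))"
    unfolding tendsto_comp_filtermap[of f z 0 "tails J le'"] z(3) .
  then show ?thesis by (rule tendsto_comp_filtermap[THEN iffD2])
qed

lemma disjoint_dual_any_index:
  fixes x :: "'i \<Rightarrow> 'a::banach_lattice"
  assumes f: "f \<in> disjoint_dual" and dir: "directed_set I le"
    and nomax: "\<not> (\<exists>m\<in>I. \<forall>i\<in>I. le i m)"
    and bdd: "bounded (x ` I)" and disj: "disjoint_on I x"
  shows "((\<lambda>\<alpha>. f (x \<alpha>)) \<longlongrightarrow> 0) (tails I le)"
proof (rule ccontr)
  assume "\<not> ?thesis"
  then obtain e where e: "e > 0" "\<not> eventually (\<lambda>\<alpha>. dist (f (x \<alpha>)) 0 < e) (tails I le)"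
    unfolding tendsto_iff by blast
  define A where "A = {i\<in>I. \<not> dist (f (x i)) 0 < e}"
  have trans: "le i k" if "le i j" "le j k" "i \<in> I" "j \<in> I" "k \<in> I" for i j k
    using dir that unfolding directed_set_def by meson
  have up: "\<exists>k\<in>I. le i k \<and> le j k" if "i \<in> I" "j \<in> I" for i j
    using dir that unfolding directed_set_def by meson
  have cof: "\<exists>j\<in>A. le i j" if "i \<in> I" for i
    using e(2) that unfolding eventually_tails[OF dir] A_def by blast
  have ub: "\<exists>u\<in>I. \<forall>i\<in>S. le i u" if "finite S" "S \<subseteq> I" for S
    using that
  proof (induction S rule: finite_induct)
    case empty
    have "I \<noteq> {}" using dir by (simp add: directed_set_def)
    then show ?case by blast
  next
    case (insert a S)
    then have aS: "a \<in> I" "S \<subseteq> I" by simp_all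
    obtain u where u: "u \<in> I" "\<forall>i\<in>S. le i u" using insert.IH[OF aS(2)] by blast
    obtain k where k: "k \<in> I" "le a k" "le u k" using up[OF aS(1) u(1)] by blast
    have "le i k" if "i \<in> S" for i
    proof (rule trans[of i u k])
      show "le i u" using u(2) that by blast
      show "i \<in> I" using aS(2) that by blast
    qed (fact k(3) u(1) k(1))+
    with k(2) have "\<forall>i\<in>insert a S. le i k" by simp
    with k(1) show ?case by (rule bexI[rotated])
  qed
  have "infinite A"
  proof
    assume "finite A"
    moreover have "A \<subseteq> I" by (auto simp: A_def)
    ultimately obtain u where u: "u \<in> I" "\<forall>i\<in>A. le i u" using ub[of A] by blast
    have "le i u" if i: "i \<in> I" for i
    proof -
      obtain j where "j \<in> A" "le i j" using cof[OF i] by blast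
      then show ?thesis using trans[of i j u] u i A_def by blast
    qed
    with nomax u(1) show False by blast
  qed
  then obtain s :: "nat \<Rightarrow> 'i" where s: "inj s" "range s \<subseteq> A"
    using infinite_countable_subset by blast
  have "linear f" using f by (simp add: disjoint_dual_def bounded_linear.linear)
  have sA: "s n \<in> I" "\<not> dist (f (x (s n))) 0 < e" for n
    using s(2) unfolding A_def by auto
  have "f (x (s 0)) \<noteq> 0" using sA(2)[of 0] e(1) by auto
  then have nz: "x (s 0) \<noteq> 0" using linear_0[OF \<open>linear f\<close>] by auto
  define r :: "nat \<Rightarrow> 'a net_index" where "r n = (real n *\<^sub>R x (s 0), {})" for n
  have r: "inj r" using nz by (auto simp: inj_on_def r_def)
  define y :: "'a net_index \<Rightarrow> 'a" where "y = (\<lambda>p. x (s (inv r p)))"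
  have y: "y (r n) = x (s n)" for n using r by (simp add: y_def)
  define le' where "le' = (\<lambda>p q. inv r p \<le> inv r q)"
  have dir': "directed_set (range r) le'"
    using directed_set_nat r unfolding directed_set_def le'_def by simp
  have "\<exists>i. \<not> i \<le> m" for m :: nat
    by (intro exI[of _ "Suc m"]) simp
  then have "\<not> (\<exists>m\<in>range r. \<forall>i\<in>range r. le' i m)"
    using r unfolding le'_def by simp
  moreover have "y ` range r \<subseteq> x ` I" using sA(1) y by auto
  then have "bounded (y ` range r)" using bdd bounded_subset by blast
  moreover have "disjoint_on (range r) y"
    unfolding disjoint_on_def
  proof (intro ballI impI)
    fix p q assume "p \<in> range r" "q \<in> range r" "p \<noteq> q"
    then obtain m n where "p = r m" "q = r n" "s m \<noteq> s n" using s(1) by (auto dest: injD)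
    then show "inf \<bar>y p\<bar> \<bar>y q\<bar> = 0" using disj sA(1) y unfolding disjoint_on_def by simp
  qed
  ultimately have "((\<lambda>p. f (y p)) \<longlongrightarrow> 0) (tails (range r) le')"
    using f dir' unfolding disjoint_dual_def by blast
  from eventually_tails_witness[OF dir' tendstoD[OF this e(1)]]
  obtain n where "dist (f (y (r n))) 0 < e" by auto
  then show False using sA(2)[of n] y by simp
qed

end

theory Submission
  imports Defs
begin

text \<open>
  All nine conditions are compared with one quantitative property of the modulus \<open>\<bar>f\<bar>\<close>, called
  \<open>uniformly_truncates\<close> below: for every norm bound \<open>M\<close> and every \<open>e > 0\<close> there is a single
  \<open>u \<ge> 0\<close> with \<open>\<bar>f\<bar> ((x - u)\<^sup>+) \<le> e\<close> for all \<open>x \<ge> 0\<close> of norm at most \<open>M\<close>.  In other words, up to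
  \<open>e\<close> the functional sees of \<open>x\<close> only the order bounded part \<open>inf x u\<close>.

  The property implies every condition.  For a norm bounded net \<open>x\<close>, cutting the positive and
  negative parts at \<open>u\<close> changes \<open>f (x i)\<close> by at most \<open>2 * e\<close>.  What remains is dominated by
  \<open>inf \<bar>x i\<bar> u\<close>, hence tends to zero by order continuity of \<open>f\<close> if \<open>x\<close> is uo-null
  (\<open>uo_null_imp_null\<close>), and by weak convergence tested on \<open>\<bar>f\<bar>\<close> if \<open>x\<close> is uaw-null, in particular
  if it is un-null (\<open>uaw_null_imp_null\<close>).  For disjoint functionals \<open>g n\<close> in \<open>[0, \<bar>f\<bar>]\<close> the same cut
  bounds \<open>onorm (g n)\<close> by \<open>e + g n u\<close>, and \<open>g n u\<close> is summable because disjoint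
  functionals below \<open>\<bar>f\<bar>\<close> have all their partial sums below \<open>\<bar>f\<bar>\<close>.

  Each condition implies that \<open>f\<close> tends to zero along norm bounded disjoint sequences.  Such
  sequences are uo-null and uaw-null in every Banach lattice, and un-null if the norm is order
  continuous.  From disjoint functionals one passes to disjoint sequences by localising: for
  \<open>w \<ge> 0\<close> the component \<open>x \<mapsto> sup k. \<bar>f\<bar> (inf x (k *\<^sub>R w))\<close> of \<open>\<bar>f\<bar>\<close> agrees with \<open>\<bar>f\<bar>\<close> at \<open>w\<close>, and
  disjoint elements have disjoint components.

  The circle closes by a disjointification (\<open>uniformly_truncates_if_disjoint_null\<close>): if no \<open>u\<close>
  works for some \<open>e\<close>, choosing each new element against a large multiple of all earlier ones and
  subtracting a little of a common majorant produces a bounded disjoint sequence on which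
  \<open>\<bar>f\<bar>\<close> stays away from zero.
\<close>

section \<open>Inequalities in Banach lattices\<close>

lemma norm_mono_cone:
  fixes x y :: "'a::banach_lattice"
  assumes "0 \<le> x" "x \<le> y"
  shows "norm x \<le> norm y"
  using assms order_trans[OF assms] by (intro norm_abs_mono) simp

lemma norm_abs [simp]:
  fixes x :: "'a::banach_lattice"
  shows "norm \<bar>x\<bar> = norm x"
  by (rule antisym) (auto intro: norm_abs_mono)

text \<open>
  Monotonicity of the norm forces a Banach lattice to be Archimedean, since \<open>k * norm v\<close> stays
  bounded.
\<close>
lemma archimedean_cone:
  fixes u v :: "'a::banach_lattice"
  assumes v: "0 \<le> v" and le: "\<And>k. real k *\<^sub>R v \<le> u"
  shows "v = 0"
proof (rule ccontr)
  assume "v \<noteq> 0"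
  then obtain k where "norm u < real k * norm v"
    using reals_Archimedean3[of "norm v"] by auto
  moreover have "norm (real k *\<^sub>R v) \<le> norm u"
    using v le by (intro norm_mono_cone) (simp_all add: scaleR_nonneg_nonneg)
  ultimately show False by simp
qed

text \<open>
  The positive cone is norm closed because the negative part of the limit \<open>l\<close> is dominated by
  \<open>\<bar>x n - l\<bar>\<close>.
\<close>
lemma limit_nonneg:
  fixes x :: "nat \<Rightarrow> 'a::banach_lattice"
  assumes lim: "x \<longlonglongrightarrow> l" and pos: "\<And>n. 0 \<le> x n"
  shows "0 \<le> l"
proof -
  have "norm (pprt (- l)) \<le> norm (x n - l)" for n
  proof -
    have "- l \<le> \<bar>x n - l\<bar>"
      using order_trans[OF _ abs_ge_self[of "x n - l"], of "- l"] pos[of n] by simp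
    then have "pprt (- l) \<le> \<bar>x n - l\<bar>" by (simp add: pprt_def)
    then show ?thesis using norm_mono_cone[of "pprt (- l)" "\<bar>x n - l\<bar>"] by simp
  qed
  moreover have "(\<lambda>n. norm (x n - l)) \<longlonglongrightarrow> 0"
    using lim by (simp add: LIM_zero tendsto_norm_zero)
  ultimately have "norm (pprt (- l)) \<le> 0"
    by (intro LIMSEQ_le_const[where X = "\<lambda>n. norm (x n - l)"]) auto
  then have "pprt (- l) = 0" by simp
  then have "- l \<le> 0" by (simp add: le_zero_iff_zero_pprt)
  then show ?thesis by simp
qed

lemma term_le_suminf_cone:
  fixes x :: "nat \<Rightarrow> 'a::banach_lattice"
  assumes sum: "summable x" and pos: "\<And>n. 0 \<le> x n"
  shows "x n \<le> suminf x"
proof -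
  have "(\<lambda>m. sum x {..<m + Suc n} - x n) \<longlonglongrightarrow> suminf x - x n"
    using LIMSEQ_ignore_initial_segment[OF summable_LIMSEQ[OF sum], of "Suc n"]
    by (rule tendsto_diff) (rule tendsto_const)
  moreover have "0 \<le> sum x {..<m + Suc n} - x n" for m
  proof -
    have "sum x {n} \<le> sum x {..<m + Suc n}"
      by (rule sum_mono2) (auto simp: pos)
    then show ?thesis by simp
  qed
  ultimately have "0 \<le> suminf x - x n" by (rule limit_nonneg)
  then show ?thesis by simp
qed

lemma pprt_le_abs:
  fixes x :: "'a::banach_lattice"
  shows "pprt x \<le> \<bar>x\<bar>" "pprt (- x) \<le> \<bar>x\<bar>"
  by (simp_all add: pprt_def abs_ge_self abs_ge_minus_self)

lemma pprt_split:
  fixes x :: "'a::banach_lattice"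
  shows "x = pprt x - pprt (- x)" "\<bar>x\<bar> = pprt x + pprt (- x)"
  by (simp_all add: pprt_neg abs_prts flip: prts)

lemma diff_inf_eq_pprt:
  fixes x u :: "'a::banach_lattice"
  shows "x - inf x u = pprt (x - u)"
  unfolding diff_inf_eq_sup add_sup_distrib_left pprt_def by (subst sup_commute) simp

lemma inf_add_le:
  fixes a b w :: "'a::banach_lattice"
  assumes "0 \<le> a" "0 \<le> b" "0 \<le> w"
  shows "inf (a + b) w \<le> inf a w + inf b w"
proof -
  have "inf (a + b) w \<le> w + c" "inf (a + b) w \<le> c + w" if "0 \<le> c" for c
    using order_trans[OF inf_le2, of w] that by simp_all
  with assms show ?thesis by (simp add: add_inf_distrib_left add_inf_distrib_right)
qed

section \<open>Disjoint elements\<close>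

text \<open>The sum of two disjoint elements is their supremum.\<close>
lemma disjoint_add_le:
  fixes a b y :: "'a::banach_lattice"
  assumes "inf a b = 0" "a \<le> y" "b \<le> y"
  shows "a + b \<le> y"
  unfolding add_eq_inf_sup[of a b] using assms by simp

lemma disjoint_mono:
  fixes a b :: "'a::banach_lattice"
  assumes "inf a b = 0" "0 \<le> a'" "0 \<le> b'" "a' \<le> a" "b' \<le> b"
  shows "inf a' b' = 0"
  using inf_mono[OF assms(4,5)] assms(1-3) by (simp add: order.antisym)

lemma disjoint_scale:
  fixes a b :: "'a::banach_lattice"
  assumes ab: "inf a b = 0" "0 \<le> a" "0 \<le> b" and c: "0 \<le> c"
  shows "inf (c *\<^sub>R a) b = 0"
proof -
  have nat: "inf (real k *\<^sub>R a) b = 0" for k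
  proof (induction k)
    case (Suc k)
    have "inf (a + real k *\<^sub>R a) b \<le> inf a b + inf (real k *\<^sub>R a) b"
      using ab by (intro inf_add_le) (simp_all add: scaleR_nonneg_nonneg)
    moreover have "0 \<le> inf (a + real k *\<^sub>R a) b"
      using ab by (simp add: scaleR_nonneg_nonneg)
    ultimately show ?case using Suc ab by (simp add: scaleR_add_left order.antisym)
  qed (use ab in \<open>simp add: inf_absorb1\<close>)
  obtain k where "c \<le> real k" using real_arch_simple by blast
  then show ?thesis
    using ab c by (intro disjoint_mono[OF nat[of k]])
      (auto intro: scaleR_nonneg_nonneg scaleR_right_mono)
qed

lemma disjoint_prts:
  fixes a :: "'a::banach_lattice"
  shows "inf (pprt a) (pprt (- a)) = 0"
proof -
  have "inf (pprt a) (pprt (- a)) + nprt a = inf a 0"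
    by (simp add: pprt_neg add_inf_distrib_right flip: prts)
  then show ?thesis by (simp add: nprt_def)
qed

text \<open>
  For \<open>c * r = 1\<close> the second element is \<open>c\<close> times the negative part of \<open>a - r *\<^sub>R b\<close>, so this is
  the disjointness of positive and negative part up to a scalar.  In this form it makes two
  elements disjoint as soon as a suitable multiple of each has been subtracted from the other.
\<close>
lemma disjoint_prts_scaled:
  fixes a b :: "'a::banach_lattice"
  assumes c: "0 \<le> c" and r: "0 \<le> r" "1 \<le> c * r"
    and ab: "0 \<le> a" "0 \<le> b"
  shows "inf (pprt (a - r *\<^sub>R b)) (pprt (b - c *\<^sub>R a)) = 0"
proof -
  define d where "d = a - r *\<^sub>R b"
  have "b \<le> (c * r) *\<^sub>R b" using scaleR_right_mono[OF r(2) ab(2)] by simp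
  then have "b - c *\<^sub>R a \<le> c *\<^sub>R (- d)" by (simp add: d_def scaleR_diff_right)
  also have "\<dots> \<le> c *\<^sub>R pprt (- d)" using c by (intro scaleR_left_mono) (simp_all add: pprt_def)
  finally have "pprt (b - c *\<^sub>R a) \<le> c *\<^sub>R pprt (- d)"
    using c by (simp add: pprt_def[of "b - _"] scaleR_nonneg_nonneg)
  note le = this
  have "inf (c *\<^sub>R pprt (- d)) (pprt d) = 0"
    using disjoint_prts[of d] c by (intro disjoint_scale) (simp_all add: inf_commute)
  from disjoint_mono[OF this _ _ le order_refl]
  have "inf (pprt (b - c *\<^sub>R a)) (pprt d) = 0" by simp
  then show ?thesis by (simp add: d_def inf_commute)
qed

text \<open>
  By induction, since \<open>w n\<close> is disjoint from the earlier partial sum as well.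
\<close>
lemma disjoint_sum_le:
  fixes w :: "nat \<Rightarrow> 'a::banach_lattice"
  assumes w0: "\<And>n. 0 \<le> w n" and wu: "\<And>n. w n \<le> u" and u: "0 \<le> u"
    and disj: "\<And>m n. m \<noteq> n \<Longrightarrow> inf (w m) (w n) = 0"
  shows "(\<Sum>i<n. w i) \<le> u"
proof (induction n)
  case (Suc n)
  have "inf (\<Sum>i<k. w i) (w n) = 0" if "k \<le> n" for k
    using that
  proof (induction k)
    case (Suc k)
    have "inf ((\<Sum>i<k. w i) + w k) (w n) \<le> inf (\<Sum>i<k. w i) (w n) + inf (w k) (w n)"
      by (intro inf_add_le sum_nonneg w0)
    also have "\<dots> = 0" using Suc disj[of k n] by simp
    finally show ?case
      using w0 by (intro order.antisym) (simp_all add: sum_nonneg)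
  qed (use w0 in \<open>simp add: inf_absorb1\<close>)
  from disjoint_add_le[OF this[OF order_refl] Suc wu] show ?case by simp
qed (use u in simp)

section \<open>Positive functionals and the modulus of a functional\<close>

lemma positive_functional_mono:
  fixes g :: "'a::banach_lattice \<Rightarrow> real"
  assumes "linear g" "dual_le (\<lambda>_. 0) g" "x \<le> y"
  shows "g x \<le> g y"
  using assms(2)[unfolded dual_le_def, rule_format, of "y - x"] assms(1,3) by (simp add: linear_diff)

text \<open>
  The defect \<open>h s = T (s *\<^sub>R x) - s * T x\<close> of homogeneity is additive in \<open>s\<close>, vanishes at the
  integers and so is bounded by its values on \<open>[0, 1)\<close>.  A bounded additive function is zero.
\<close>
lemma additive_bounded_imp_bounded_linear:
  fixes T :: "'a::real_normed_vector \<Rightarrow> real"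
  assumes add: "\<And>x y. T (x + y) = T x + T y"
    and bd: "\<And>x. \<bar>T x\<bar> \<le> K * norm x"
  shows "bounded_linear T"
proof (rule bounded_linear_intro[of T K])
  show "T (x + y) = T x + T y" for x y by (rule add)
  show "norm (T x) \<le> norm x * K" for x using bd[of x] by (simp add: mult.commute)
  fix r :: real and x :: 'a
  define h where "h s = T (s *\<^sub>R x) - s * T x" for s
  have h_add: "h (s + t) = h s + h t" for s t
    by (simp add: h_def scaleR_add_left add algebra_simps)
  have h0: "h 0 = 0" using h_add[of 0 0] by simp
  have h_neg: "h (- s) = - h s" for s using h_add[of s "- s"] h0 by simp
  have h_nat: "h (real n * s) = real n * h s" for n s
    by (induction n) (simp_all add: h0 h_add distrib_right)
  have h1: "h 1 = 0" by (simp add: h_def)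
  have h_int: "h (of_int k) = 0" for k
    by (cases k rule: int_cases2) (use h_nat[of _ 1] h1 h_neg in simp_all)
  have h_bd: "\<bar>h s\<bar> \<le> 2 * (K * norm x)" for s
  proof -
    have "h s = h (frac s)"
      using h_add[of "frac s" "of_int \<lfloor>s\<rfloor>"] h_int by (simp add: frac_def)
    moreover have "\<bar>h (frac s)\<bar> \<le> \<bar>T (frac s *\<^sub>R x)\<bar> + \<bar>frac s * T x\<bar>"
      by (simp add: h_def)
    moreover have "\<bar>T (frac s *\<^sub>R x)\<bar> \<le> K * norm x"
    proof -
      have "0 \<le> K * norm x" using bd[of x] by linarith
      then have "frac s * (K * norm x) \<le> 1 * (K * norm x)"
        using frac_lt_1[of s] by (intro mult_right_mono) auto
      then show ?thesis using bd[of "frac s *\<^sub>R x"] by (simp add: mult.left_commute)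
    qed
    moreover have "\<bar>frac s * T x\<bar> \<le> K * norm x"
    proof -
      have "frac s * \<bar>T x\<bar> \<le> 1 * \<bar>T x\<bar>"
        using frac_lt_1[of s] by (intro mult_right_mono) auto
      then show ?thesis using bd[of x] by (simp add: abs_mult)
    qed
    ultimately show ?thesis by linarith
  qed
  have "h r = 0"
  proof (rule ccontr)
    assume "h r \<noteq> 0"
    then obtain n where "2 * (K * norm x) < real n * \<bar>h r\<bar>"
      using reals_Archimedean3[of "\<bar>h r\<bar>"] by auto
    then show False using h_bd[of "real n * r"] by (simp add: h_nat abs_mult)
  qed
  then show "T (r *\<^sub>R x) = r *\<^sub>R T x" by (simp add: h_def)
qed

text \<open>
  Functionals are constructed on the positive cone, where suprema behave additively, and then
  extended by differences.
\<close>
lemma functional_on_cone_extends: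
  fixes p :: "'a::banach_lattice \<Rightarrow> real"
  assumes add: "\<And>x y. 0 \<le> x \<Longrightarrow> 0 \<le> y \<Longrightarrow> p (x + y) = p x + p y"
    and pos: "\<And>x. 0 \<le> x \<Longrightarrow> 0 \<le> p x"
    and bd: "\<And>x. 0 \<le> x \<Longrightarrow> p x \<le> K * norm x" and K: "0 \<le> K"
  obtains T where "bounded_linear T" "\<And>x. 0 \<le> x \<Longrightarrow> T x = p x"
proof
  define T where "T x = p (pprt x) - p (pprt (- x))" for x
  have diff: "T (a - b) = p a - p b" if ab: "0 \<le> a" "0 \<le> b" for a b
  proof -
    have "pprt (a - b) + b = pprt (- (a - b)) + a"
      using pprt_split(1)[of "a - b"] by (simp add: algebra_simps)
    from arg_cong[OF this, of p] show ?thesis using ab by (simp add: add T_def)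
  qed
  have "p 0 = 0" using add[of 0 0] by simp
  then show ext: "T x = p x" if "0 \<le> x" for x using diff[of x 0] that by simp
  show "bounded_linear T"
  proof (rule additive_bounded_imp_bounded_linear)
    fix x y :: 'a
    have "x + y = (pprt x + pprt y) - (pprt (- x) + pprt (- y))"
      by (subst pprt_split(1)[of x], subst pprt_split(1)[of y]) simp
    then have "T (x + y) = p (pprt x + pprt y) - p (pprt (- x) + pprt (- y))"
      by (simp only: diff add_nonneg_nonneg zero_le_pprt)
    then show "T (x + y) = T x + T y" by (simp add: add T_def)
  next
    fix x :: 'a
    have le: "p z \<le> K * norm x" if "0 \<le> z" "z \<le> \<bar>x\<bar>" for z
      using order_trans[OF bd[OF that(1)] mult_left_mono[OF norm_mono_cone[OF that] K]] by simp
    have "p (pprt x) \<le> K * norm x" "p (pprt (- x)) \<le> K * norm x"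
      by (simp_all add: le pprt_le_abs)
    moreover have "0 \<le> p (pprt x)" "0 \<le> p (pprt (- x))" by (simp_all add: pos)
    ultimately show "\<bar>T x\<bar> \<le> K * norm x" by (simp add: T_def abs_le_iff)
  qed
qed

text \<open>Clamping \<open>y\<close> to the interval \<open>[- a, a]\<close> leaves a remainder in \<open>[- b, b]\<close>.\<close>
lemma riesz_decomposition:
  fixes y a b :: "'a::banach_lattice"
  assumes y: "\<bar>y\<bar> \<le> a + b" and a: "0 \<le> a" and b: "0 \<le> b"
  obtains y1 y2 where "y = y1 + y2" "\<bar>y1\<bar> \<le> a" "\<bar>y2\<bar> \<le> b"
proof
  define y1 where "y1 = inf (sup y (- a)) a"
  have "y \<le> a + b" "- y \<le> a + b"
    using order_trans[OF abs_ge_self y] order_trans[OF abs_ge_minus_self y] by auto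
  then have *: "y - a \<le> b" "- b \<le> y + a"
    by (simp_all add: diff_le_eq minus_le_iff[of b] minus_le_iff[of y] add.commute)
  show "y = y1 + (y - y1)" by simp
  have "- a \<le> a" using a by (simp add: minus_le_self_iff)
  then have "- a \<le> y1" "y1 \<le> a" by (simp_all add: y1_def)
  then show "\<bar>y1\<bar> \<le> a" by (simp add: abs_le_iff minus_le_iff)
  have "y - y1 = sup (inf 0 (y + a)) (y - a)"
    unfolding y1_def diff_inf_eq_sup neg_sup_eq_inf add_sup_distrib_left add_inf_distrib_left by simp
  moreover have "inf 0 (y + a) \<le> b" using le_infI1[OF b] .
  moreover have "- b \<le> inf 0 (y + a)" using b * by simp
  ultimately have "y - y1 \<le> b" "- b \<le> y - y1" using * by (simp_all add: le_supI1)
  then show "\<bar>y - y1\<bar> \<le> b" using minus_le_iff[of b "y - y1"] by (blast intro: abs_leI)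
qed

text \<open>
  The Riesz--Kantorovich formula \<open>\<bar>f\<bar> x = sup {f y | \<bar>y\<bar> \<le> x}\<close>, whose additivity on the cone is the
  decomposition property.
\<close>
lemma riesz_kantorovich_modulus:
  fixes f :: "'a::banach_lattice \<Rightarrow> real"
  assumes f: "bounded_linear f"
  obtains P where "bounded_linear P" "\<And>x y. \<bar>y\<bar> \<le> x \<Longrightarrow> f y \<le> P x"
    "\<And>x e. 0 \<le> x \<Longrightarrow> 0 < e \<Longrightarrow> \<exists>y. \<bar>y\<bar> \<le> x \<and> P x - e < f y"
proof -
  interpret f: bounded_linear f by (rule f)
  obtain K where K: "0 \<le> K" "\<And>x. norm (f x) \<le> norm x * K" using f.nonneg_bounded by blast
  define p where "p x = (SUP y\<in>{y. \<bar>y\<bar> \<le> x}. f y)" for x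
  have le_K: "f y \<le> K * norm x" if "\<bar>y\<bar> \<le> x" for x y
  proof -
    have "norm y \<le> norm x" using norm_mono_cone[of "\<bar>y\<bar>" x] that by simp
    then have "norm y * K \<le> norm x * K" using K(1) by (rule mult_right_mono)
    then show ?thesis using K(2)[of y] by (simp add: mult.commute)
  qed
  have bdd: "bdd_above (f ` {y. \<bar>y\<bar> \<le> x})" for x
    using le_K by (intro bdd_aboveI[of _ "K * norm x"]) auto
  have upper: "f y \<le> p x" if "\<bar>y\<bar> \<le> x" for x y
    unfolding p_def using that by (intro cSUP_upper bdd) simp
  have least: "p x \<le> c" if "0 \<le> x" "\<And>y. \<bar>y\<bar> \<le> x \<Longrightarrow> f y \<le> c" for x c
    unfolding p_def using that by (intro cSUP_least) (auto intro: exI[of _ 0])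
  have padd: "p (a + b) = p a + p b" if ab: "0 \<le> a" "0 \<le> b" for a b
  proof (rule antisym)
    show "p (a + b) \<le> p a + p b"
    proof (rule least)
      fix y assume "\<bar>y\<bar> \<le> a + b"
      then obtain y1 y2 where "y = y1 + y2" "\<bar>y1\<bar> \<le> a" "\<bar>y2\<bar> \<le> b"
        using riesz_decomposition ab by blast
      then show "f y \<le> p a + p b" using upper by (simp add: f.add add_mono)
    qed (use ab in simp)
    have "f y1 + f y2 \<le> p (a + b)" if "\<bar>y1\<bar> \<le> a" "\<bar>y2\<bar> \<le> b" for y1 y2
      using upper[of "y1 + y2" "a + b"] order_trans[OF abs_triangle_ineq add_mono[OF that]]
      by (simp add: f.add)
    then have "f y1 \<le> p (a + b) - p b" if "\<bar>y1\<bar> \<le> a" for y1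
      using least[OF ab(2), of "p (a + b) - f y1"] that by (force simp: algebra_simps)
    then show "p a + p b \<le> p (a + b)"
      using least[OF ab(1), of "p (a + b) - p b"] by (simp add: algebra_simps)
  qed
  have "0 \<le> p x" if "0 \<le> x" for x using upper[of 0 x] that by (simp add: f.zero)
  moreover have "p x \<le> K * norm x" if "0 \<le> x" for x using least[OF that] le_K by blast
  ultimately obtain P where P: "bounded_linear P" "\<And>x. 0 \<le> x \<Longrightarrow> P x = p x"
    using functional_on_cone_extends[of p K] padd K(1) by blast
  show ?thesis
  proof
    show "bounded_linear P" by (rule P(1))
    show "f y \<le> P x" if "\<bar>y\<bar> \<le> x" for x y
      using upper[OF that] P(2)[OF order_trans[OF abs_ge_zero that]] by simp
    show "\<exists>y. \<bar>y\<bar> \<le> x \<and> P x - e < f y" if "0 \<le> x" "0 < e" for x e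
    proof (rule ccontr)
      assume "\<not> ?thesis"
      then have "p x \<le> P x - e" by (intro least that) (auto simp: not_less)
      then show False using that P(2) by simp
    qed
  qed
qed

lemma is_dual_sup_unique:
  fixes s t :: "'a::banach_lattice \<Rightarrow> real"
  assumes "is_dual_sup g h s" "is_dual_sup g h t"
  shows "s = t"
proof
  fix x
  interpret s: bounded_linear s using assms by (simp add: is_dual_sup_def)
  interpret t: bounded_linear t using assms by (simp add: is_dual_sup_def)
  have "dual_le s t" "dual_le t s" using assms by (simp_all add: is_dual_sup_def)
  then have cone: "s y = t y" if "0 \<le> y" for y using that by (simp add: dual_le_def order.antisym)
  have "s (pprt x - pprt (- x)) = t (pprt x - pprt (- x))" by (simp add: s.diff t.diff cone)
  then show "s x = t x" by (simp flip: pprt_split(1))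
qed

lemma dual_abs_eqI: "is_dual_sup f (\<lambda>x. - f x) s \<Longrightarrow> dual_abs f = s"
  unfolding dual_abs_def by (blast intro: the_equality is_dual_sup_unique)

lemma dual_abs_of_nonneg:
  fixes g :: "'a::banach_lattice \<Rightarrow> real"
  assumes "bounded_linear g" "dual_le (\<lambda>_. 0) g"
  shows "dual_abs g = g"
  using assms by (intro dual_abs_eqI) (auto simp: is_dual_sup_def dual_le_def)

text \<open>
  The modulus defined by its order property is the functional of the Riesz--Kantorovich formula:
  a common upper bound \<open>t\<close> of \<open>f\<close> and \<open>- f\<close> satisfies \<open>f y \<le> t \<bar>y\<bar>\<close>.  Domination and approximation
  are the two halves of the formula, and all later arguments use the modulus only through them.
\<close>
lemma
  fixes f :: "'a::banach_lattice \<Rightarrow> real"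
  assumes f: "bounded_linear f"
  shows bounded_linear_dual_abs: "bounded_linear (dual_abs f)"
    and le_dual_abs: "\<And>x y. \<bar>y\<bar> \<le> x \<Longrightarrow> \<bar>f y\<bar> \<le> dual_abs f x"
    and dual_abs_approx: "\<And>x e. 0 \<le> x \<Longrightarrow> 0 < e \<Longrightarrow> \<exists>y. \<bar>y\<bar> \<le> x \<and> dual_abs f x - e < f y"
proof -
  interpret f: bounded_linear f by (rule f)
  obtain P where P: "bounded_linear P" "\<And>x y. \<bar>y\<bar> \<le> x \<Longrightarrow> f y \<le> P x"
    "\<And>x e. 0 \<le> x \<Longrightarrow> 0 < e \<Longrightarrow> \<exists>y. \<bar>y\<bar> \<le> x \<and> P x - e < f y"
    using riesz_kantorovich_modulus[OF f] by blast
  have abs: "\<bar>f y\<bar> \<le> P x" if "\<bar>y\<bar> \<le> x" for x y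
    using P(2)[of y x] P(2)[of "- y" x] that by (simp add: abs_le_iff f.neg)
  have "P x \<le> t x"
    if t: "bounded_linear t" "dual_le f t" "dual_le (\<lambda>x. - f x) t" and x: "0 \<le> x" for t x
  proof (rule field_le_epsilon)
    interpret t: bounded_linear t by (rule t)
    have f_le: "f z \<le> t z" "- f z \<le> t z" if "0 \<le> z" for z
      using t(2,3) that by (simp_all add: dual_le_def)
    fix e :: real assume "0 < e"
    then obtain y where y: "\<bar>y\<bar> \<le> x" "P x - e < f y" using P(3) x by blast
    have "f y = f (pprt y) - f (pprt (- y))" by (simp add: f.diff[symmetric] flip: pprt_split(1))
    also have "\<dots> \<le> t (pprt y) + t (pprt (- y))"
      using f_le(1)[of "pprt y"] f_le(2)[of "pprt (- y)"] by simp
    also have "\<dots> = t \<bar>y\<bar>" by (simp add: pprt_split(2) t.add)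
    also have "\<dots> \<le> t x"
      using f_le[of "x - \<bar>y\<bar>"] y(1) by (simp add: t.diff)
    finally show "P x \<le> t x + e" using y(2) by simp
  qed
  moreover have "f x \<le> P x" "- f x \<le> P x" if "0 \<le> x" for x
    using abs[of x x] that by (simp_all add: abs_le_iff)
  ultimately have "is_dual_sup f (\<lambda>x. - f x) P"
    unfolding is_dual_sup_def dual_le_def using P(1) by blast
  then have eq: "dual_abs f = P" by (rule dual_abs_eqI)
  show "bounded_linear (dual_abs f)" "\<And>x y. \<bar>y\<bar> \<le> x \<Longrightarrow> \<bar>f y\<bar> \<le> dual_abs f x"
    "\<And>x e. 0 \<le> x \<Longrightarrow> 0 < e \<Longrightarrow> \<exists>y. \<bar>y\<bar> \<le> x \<and> dual_abs f x - e < f y"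
    using P(1,3) abs unfolding eq by blast+
qed

lemma nonneg_dual_abs:
  assumes "bounded_linear f"
  shows "dual_le (\<lambda>_. 0) (dual_abs f)"
  using le_dual_abs[OF assms, of 0] linear_0[OF bounded_linear.linear[OF assms]]
  by (simp add: dual_le_def)

text \<open>
  An unbounded functional equals \<open>1\<close> on a sequence converging to zero so fast that
  \<open>\<bar>y n\<bar> \<le> u / (n + 1)\<close> for one \<open>u\<close>.  Such a sequence is order null.
\<close>
lemma order_cont_imp_bounded_linear:
  fixes f :: "'a::banach_lattice \<Rightarrow> real"
  assumes f: "f \<in> order_cont_dual"
  shows "bounded_linear f"
proof (rule ccontr)
  assume unbdd: "\<not> bounded_linear f"
  have lin: "linear f" using f by (simp add: order_cont_dual_def)
  \<comment> \<open>The factor \<open>2 ^ n\<close> makes the series defining \<open>u\<close> converge, the factor \<open>Suc n\<close> gives the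
    bounds \<open>u / (n + 1)\<close>.\<close>
  have "\<exists>y. f y = 1 \<and> norm y \<le> (1/2) ^ n / real (Suc n)" for n
  proof -
    have "\<not> (\<forall>x. norm (f x) \<le> norm x * (real (Suc n) * 2 ^ n))"
      using unbdd lin unfolding bounded_linear_def bounded_linear_axioms_def by blast
    then obtain x where x: "norm x * (real (Suc n) * 2 ^ n) < norm (f x)"
      by (auto simp: not_le)
    have "0 \<le> norm x * (real (Suc n) * 2 ^ n)" by simp
    with x have fx: "0 < norm (f x)" by linarith
    define A where "A = real (Suc n) * 2 ^ n"
    have "0 < A" by (simp add: A_def)
    then have "norm x / norm (f x) \<le> 1 / A" 
      using x[folded A_def] fx by (simp add: field_simps)
    also have "1 / A = (1/2) ^ n / real (Suc n)" by (simp add: A_def power_one_over)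
    finally have "norm x / norm (f x) \<le> (1/2) ^ n / real (Suc n)" .
    moreover have "f ((1 / f x) *\<^sub>R x) = 1"
      using fx lin by (simp add: linear_cmul)
    ultimately show ?thesis by (intro exI[of _ "(1 / f x) *\<^sub>R x"]) simp
  qed
  then obtain y where y: "\<And>n. f (y n) = 1" "\<And>n. norm (y n) \<le> (1/2) ^ n / real (Suc n)"
    by metis
  define w where "w n = real (Suc n) *\<^sub>R \<bar>y n\<bar>" for n
  have w0: "0 \<le> w n" for n by (simp add: w_def scaleR_nonneg_nonneg)
  have "norm (w n) \<le> (1/2) ^ n" for n
    using y(2)[of n]
    by (simp add: w_def pos_le_divide_eq mult.commute del: of_nat_Suc)
  then have sum: "summable w"
    by (intro summable_comparison_test[of w "\<lambda>n. (1/2) ^ n"]) (auto intro: summable_geometric)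
  have bound: "\<bar>y n\<bar> \<le> (1 / real (Suc n)) *\<^sub>R suminf w" for n
    using scaleR_left_mono[OF term_le_suminf_cone[OF sum w0, of n], of "1 / real (Suc n)"]
    by (simp add: w_def[of n])
  have u0: "0 \<le> suminf w" using order_trans[OF w0 term_le_suminf_cone[OF sum w0]] .
  have antimono: "(1 / real (Suc j)) *\<^sub>R suminf w \<le> (1 / real (Suc i)) *\<^sub>R suminf w"
    if "i \<le> j" for i j
    using that u0 by (intro scaleR_right_mono) (simp_all add: frac_le)
  have "z \<le> 0" if z: "\<forall>i. z \<le> (1 / real (Suc i)) *\<^sub>R suminf w" for z
  proof -
    have "pprt z = 0"
    proof (rule archimedean_cone)
      fix k
      have "pprt z \<le> (1 / real (Suc k)) *\<^sub>R suminf w"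
        unfolding pprt_def using z u0 by (simp add: scaleR_nonneg_nonneg)
      from scaleR_left_mono[OF this, of "real k"]
      have "real k *\<^sub>R pprt z \<le> (real k / real (Suc k)) *\<^sub>R suminf w" by simp
      also have "\<dots> \<le> 1 *\<^sub>R suminf w" using u0 by (intro scaleR_right_mono) simp_all
      finally show "real k *\<^sub>R pprt z \<le> suminf w" by simp
    qed simp
    then show ?thesis by (simp add: le_zero_iff_zero_pprt)
  qed
  then have dec: "decreasing_to_zero UNIV (\<le>) (\<lambda>n. (1 / real (Suc n)) *\<^sub>R suminf w)"
    unfolding decreasing_to_zero_def using antimono u0
    by (simp add: scaleR_nonneg_nonneg)
  have "order_conv y 0 sequentially"
  proof (rule order_conv_any_index[OF directed_set_nat dec])
    fix i
    have "\<bar>y n - 0\<bar> \<le> (1 / real (Suc i)) *\<^sub>R suminf w" if "i \<le> n" for n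
      using order_trans[OF bound antimono[OF that]] by simp
    then show "\<forall>\<^sub>F n in sequentially. \<bar>y n - 0\<bar> \<le> (1 / real (Suc i)) *\<^sub>R suminf w"
      using eventually_sequentiallyI[of i "\<lambda>n. \<bar>y n - 0\<bar> \<le> (1 / real (Suc i)) *\<^sub>R suminf w"] by blast
  qed
  then have "(\<lambda>n. f (y n)) \<longlonglongrightarrow> 0"
    using order_cont_dual_any_index[OF f directed_set_nat, of y] by (simp add: tails_nat)
  then show False by (simp add: y(1) LIMSEQ_const_iff)
qed

section \<open>Disjoint functionals\<close>

text \<open>
  Disjointness of positive functionals in pointwise form: every \<open>x \<ge> 0\<close> splits into a piece that
  \<open>g\<close> hardly sees and a piece that \<open>h\<close> hardly sees.
\<close>
definition dual_splits :: "('a::banach_lattice \<Rightarrow> real) \<Rightarrow> ('a \<Rightarrow> real) \<Rightarrow> bool" where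
  "dual_splits g h \<longleftrightarrow>
     (\<forall>x\<ge>0. \<forall>e>0. \<exists>y. 0 \<le> y \<and> y \<le> x \<and> g y < e \<and> h (x - y) < e)"

text \<open>
  If \<open>g\<close> and \<open>h\<close> have infimum zero, then \<open>g + h \<le> \<bar>g - h\<bar>\<close>, and an element \<open>y\<close> on which \<open>g - h\<close>
  nearly attains \<open>\<bar>g - h\<bar> x\<close> splits \<open>x\<close> as required.  Conversely a lower bound of both
  functionals is at most \<open>g y + h (x - y)\<close> at \<open>x\<close>.
\<close>
lemma dual_inf_zero_iff_splits:
  fixes g h :: "'a::banach_lattice \<Rightarrow> real"
  assumes g: "bounded_linear g" "dual_le (\<lambda>_. 0) g" and h: "bounded_linear h" "dual_le (\<lambda>_. 0) h"
  shows "is_dual_inf g h (\<lambda>_. 0) \<longleftrightarrow> dual_splits g h"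
proof
  interpret g: bounded_linear g by (rule g)
  interpret h: bounded_linear h by (rule h)
  have g0: "0 \<le> g x" and h0: "0 \<le> h x" if "0 \<le> x" for x
    using g h that by (simp_all add: dual_le_def)
  {
    assume inf: "is_dual_inf g h (\<lambda>_. 0)"
    have d: "bounded_linear (\<lambda>x. g x - h x)" by (intro bounded_linear_sub g h)
    define P where "P = dual_abs (\<lambda>x. g x - h x)"
    have P: "bounded_linear P" unfolding P_def by (rule bounded_linear_dual_abs[OF d])
    \<comment> \<open>The infimum of two functionals is half of their sum minus the modulus of their
      difference.\<close>
    define t where "t x = (1/2) * (g x + h x - P x)" for x
    have t: "bounded_linear t"
      unfolding t_def by (intro bounded_linear_const_mult bounded_linear_sub bounded_linear_add g h P)
    have "\<bar>g x - h x\<bar> \<le> P x" if "0 \<le> x" for x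
      unfolding P_def using le_dual_abs[OF d, of x x] that by simp
    then have "dual_le t g" "dual_le t h" unfolding dual_le_def t_def by (force simp: abs_le_iff)+
    then have "dual_le t (\<lambda>_. 0)" using inf t by (simp add: is_dual_inf_def)
    then have sum_le: "g x + h x \<le> P x" if "0 \<le> x" for x
      using that by (simp add: dual_le_def t_def)
    show "dual_splits g h"
      unfolding dual_splits_def
    proof (intro allI impI)
      fix x :: 'a and e :: real assume x: "0 \<le> x" and "0 < e"
      then obtain y where y: "\<bar>y\<bar> \<le> x" "P x - e < g y - h y"
        using dual_abs_approx[OF d] unfolding P_def by blast
      have yx: "pprt y \<le> x" "pprt (- y) \<le> x"
        using y(1) pprt_le_abs[of y] by (blast intro: order_trans)+
      have "g y = g (pprt y) - g (pprt (- y))" "h y = h (pprt y) - h (pprt (- y))"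
        by (simp_all add: g.diff[symmetric] h.diff[symmetric] flip: pprt_split(1))
      then have "g (x - pprt y) + h (x - pprt (- y)) + g (pprt (- y)) + h (pprt y) < e"
        using y(2) sum_le[OF x] by (simp add: g.diff h.diff)
      moreover have "0 \<le> g (x - pprt y)" "0 \<le> h (x - pprt (- y))" "0 \<le> g (pprt (- y))"
        "0 \<le> h (pprt y)" using yx by (simp_all add: g0 h0)
      ultimately have "g (x - pprt y) < e" "h (x - (x - pprt y)) < e" by simp_all
      then show "\<exists>y. 0 \<le> y \<and> y \<le> x \<and> g y < e \<and> h (x - y) < e"
        using yx by (intro exI[of _ "x - pprt y"]) simp
    qed
  }
  {
    assume split: "dual_splits g h"
    have "t x \<le> 0" if t: "bounded_linear t" "dual_le t g" "dual_le t h" and x: "0 \<le> x" for t x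
    proof (rule field_le_epsilon)
      interpret t: bounded_linear t by (rule t)
      fix e :: real assume "0 < e"
      then obtain y where y: "0 \<le> y" "y \<le> x" "g y < e / 2" "h (x - y) < e / 2"
        using split x unfolding dual_splits_def by (meson half_gt_zero)
      have "t x = t y + t (x - y)" by (simp add: t.diff)
      also have "\<dots> \<le> g y + h (x - y)" using t(2,3) y by (simp add: dual_le_def add_mono)
      finally show "t x \<le> 0 + e" using y by simp
    qed
    then show "is_dual_inf g h (\<lambda>_. 0)"
      using g h by (simp add: is_dual_inf_def dual_le_def)
  }
qed

text \<open>The supremum of the pieces \<open>g\<close> hardly sees works for both summands.\<close>
lemma dual_splits_add:
  fixes g h1 h2 :: "'a::banach_lattice \<Rightarrow> real"
  assumes g: "linear g" "dual_le (\<lambda>_. 0) g"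
    and h1: "linear h1" "dual_le (\<lambda>_. 0) h1" and h2: "linear h2" "dual_le (\<lambda>_. 0) h2"
    and s1: "dual_splits g h1" and s2: "dual_splits g h2"
  shows "dual_splits g (\<lambda>x. h1 x + h2 x)"
  unfolding dual_splits_def
proof (intro allI impI)
  fix x :: 'a and e :: real assume x: "0 \<le> x" and "0 < e"
  then have e: "0 < e / 2" by simp
  obtain y1 where y1: "0 \<le> y1" "y1 \<le> x" "g y1 < e / 2" "h1 (x - y1) < e / 2"
    using s1 x e unfolding dual_splits_def by meson
  obtain y2 where y2: "0 \<le> y2" "y2 \<le> x" "g y2 < e / 2" "h2 (x - y2) < e / 2"
    using s2 x e unfolding dual_splits_def by meson
  have "sup y1 y2 \<le> y1 + y2" using y1 y2 by simp
  then have "g (sup y1 y2) < e"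
    using positive_functional_mono[OF g, of "sup y1 y2" "y1 + y2"] y1 y2 g(1)
    by (simp add: linear_add)
  moreover have "h1 (x - sup y1 y2) < e / 2"
    using positive_functional_mono[OF h1, of "x - sup y1 y2" "x - y1"] y1(4) by simp
  moreover have "h2 (x - sup y1 y2) < e / 2"
    using positive_functional_mono[OF h2, of "x - sup y1 y2" "x - y2"] y2(4) by simp
  ultimately show "\<exists>y. 0 \<le> y \<and> y \<le> x \<and> g y < e \<and> h1 (x - y) + h2 (x - y) < e"
    using y1 y2 by (intro exI[of _ "sup y1 y2"]) (simp add: le_supI1)
qed

text \<open>Evaluate \<open>g\<close> essentially on one piece and \<open>h\<close> on the other.\<close>
lemma dual_splits_sum_le:
  fixes g h p :: "'a::banach_lattice \<Rightarrow> real"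
  assumes g: "linear g" "dual_le g p" and h: "linear h" "dual_le h p" and p: "linear p"
    and split: "dual_splits g h"
  shows "dual_le (\<lambda>x. g x + h x) p"
  unfolding dual_le_def
proof (intro allI impI)
  fix x :: 'a assume x: "0 \<le> x"
  show "g x + h x \<le> p x"
  proof (rule field_le_epsilon)
    fix e :: real assume "0 < e"
    then obtain y where y: "0 \<le> y" "y \<le> x" "g y < e / 2" "h (x - y) < e / 2"
      using split x unfolding dual_splits_def by (meson half_gt_zero)
    have "g (x - y) \<le> p (x - y)" "h y \<le> p y" using g h y by (simp_all add: dual_le_def)
    then show "g x + h x \<le> p x + e"
      using y g(1) h(1) p by (simp add: linear_diff)
  qed
qed

lemma disjoint_functionals_sum_le:
  fixes g :: "nat \<Rightarrow> 'a::banach_lattice \<Rightarrow> real"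
  assumes g: "\<And>n. linear (g n)" "\<And>n. dual_le (\<lambda>_. 0) (g n)" "\<And>n. dual_le (g n) p"
    and p: "linear p" "dual_le (\<lambda>_. 0) p" and split: "\<And>m n. m \<noteq> n \<Longrightarrow> dual_splits (g m) (g n)"
  shows "dual_le (\<lambda>x. \<Sum>i<n. g i x) p"
proof (induction n)
  case 0
  then show ?case using p(2) by simp
next
  case (Suc n)
  have lin: "linear (\<lambda>x. \<Sum>i<k. g i x)" for k by (intro linear_compose_sum ballI g)
  have pos: "dual_le (\<lambda>_. 0) (\<lambda>x. \<Sum>i<k. g i x)" for k
    using g(2) by (simp add: dual_le_def sum_nonneg)
  have "dual_splits (g n) (\<lambda>x. \<Sum>i<k. g i x)" if "k \<le> n" for k
    using that
  proof (induction k)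
    case 0
    have "g n 0 = 0" using g(1) by (rule linear_0)
    then show ?case by (auto simp: dual_splits_def intro!: exI[of _ 0])
  next
    case (Suc k)
    then have "dual_splits (g n) (\<lambda>x. (\<Sum>i<k. g i x) + g k x)"
      by (intro dual_splits_add g lin pos split) simp_all
    then show ?case by simp
  qed
  then have "dual_le (\<lambda>x. g n x + (\<Sum>i<n. g i x)) p"
    by (intro dual_splits_sum_le g lin Suc p) simp
  then show ?case by (simp add: add.commute)
qed

section \<open>Unbounded convergence of disjoint sequences\<close>

text \<open>
  With \<open>w n = inf \<bar>x n\<bar> u\<close>, the eventual upper bounds of \<open>w\<close> form a downward directed set that
  dominates the sequence.  To see that its infimum is zero, let \<open>v \<ge> 0\<close> be below all of
  them.  Then \<open>v\<close> is disjoint from every \<open>w m\<close>, so that subtracting \<open>v\<close> from an eventual bound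
  gives another one.  Iterating from \<open>u\<close> gives \<open>k *\<^sub>R v \<le> u\<close> for all \<open>k\<close>.
\<close>
lemma disjoint_seq_uo_null:
  fixes x :: "nat \<Rightarrow> 'a::banach_lattice"
  assumes disj: "disjoint_on UNIV x"
  shows "uo_null x sequentially"
  unfolding uo_null_def
proof (intro allI impI)
  fix u :: 'a assume u: "0 \<le> u"
  define w where "w n = inf \<bar>x n\<bar> u" for n
  define D where "D = {y. \<exists>N. \<forall>n\<ge>N. w n \<le> y}"
  have w0: "0 \<le> w n" and wu: "w n \<le> u" for n using u by (simp_all add: w_def)
  have uD: "u \<in> D" using wu by (auto simp: D_def)
  have wdisj: "inf (w n) (w m) = 0" if "n \<noteq> m" for m n
  proof -
    have "inf \<bar>x n\<bar> \<bar>x m\<bar> = 0" using disj that unfolding disjoint_on_def by blast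
    from disjoint_mono[OF this w0 w0] show ?thesis by (simp add: w_def)
  qed
  have D0: "0 \<le> y" if "y \<in> D" for y
    using that order_trans[OF w0] unfolding D_def by blast
  have dir: "directed_set D (\<lambda>a b. b \<le> a)"
    unfolding directed_set_def
  proof (intro conjI ballI impI)
    fix y z assume "y \<in> D" "z \<in> D"
    then obtain M N where "\<forall>n\<ge>M. w n \<le> y" "\<forall>n\<ge>N. w n \<le> z" by (auto simp: D_def)
    then have "\<forall>n\<ge>max M N. w n \<le> inf y z" by simp
    then have "inf y z \<in> D" unfolding D_def by blast
    then show "\<exists>k\<in>D. k \<le> y \<and> k \<le> z" by (rule bexI[rotated]) simp
  qed (use uD in auto)
  have null: "z \<le> 0" if zD: "\<forall>y\<in>D. z \<le> y" for z
  proof -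
    define v where "v = pprt z"
    have v0: "0 \<le> v" by (simp add: v_def)
    have vD: "v \<le> y" if "y \<in> D" for y
      using zD D0 that by (simp add: v_def pprt_def)
    \<comment> \<open>With \<open>t = inf v (w m)\<close>: as long as \<open>k *\<^sub>R t \<le> u\<close>, the element \<open>u - k *\<^sub>R t\<close> is an eventual
      bound, because \<open>t\<close> is disjoint from all later terms.  Hence \<open>t \<le> v\<close> is below it,
      and \<open>(k + 1) *\<^sub>R t \<le> u\<close>.\<close>
    have vw: "inf v (w m) = 0" for m
    proof (rule archimedean_cone)
      define t where "t = inf v (w m)"
      have t: "0 \<le> t" "t \<le> v" "t \<le> w m" using v0 w0 by (simp_all add: t_def)
      fix k
      show "real k *\<^sub>R t \<le> u"
      proof (induction k)
        case (Suc k)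
        have "w n \<le> u - real k *\<^sub>R t" if "n \<ge> Suc m" for n
        proof -
          have "inf (w m) (w n) = 0" using that by (intro wdisj) simp
          then have "inf (real k *\<^sub>R w m) (w n) = 0" using w0 by (intro disjoint_scale) simp_all
          then have "inf (real k *\<^sub>R t) (w n) = 0"
            using t w0
            by (elim disjoint_mono) (simp_all add: scaleR_nonneg_nonneg scaleR_left_mono)
          from disjoint_add_le[OF this Suc wu] show ?thesis by (simp add: algebra_simps)
        qed
        then have "u - real k *\<^sub>R t \<in> D" unfolding D_def by blast
        from order_trans[OF t(2) vD[OF this]] show ?case by (simp add: algebra_simps)
      qed (use u in simp)
    qed (use v0 w0 in simp)
    have "y - v \<in> D" if y: "y \<in> D" for y
    proof -
      obtain N where "\<forall>n\<ge>N. w n \<le> y" using y by (auto simp: D_def)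
      then have "\<forall>n\<ge>N. w n \<le> y - v"
        using disjoint_add_le[OF vw vD[OF y]] by (simp add: algebra_simps)
      then show ?thesis unfolding D_def by blast
    qed
    then have "u - real k *\<^sub>R v \<in> D" for k
      using uD by (induction k) (simp_all add: scaleR_add_left diff_add_eq_diff_diff_swap)
    then have "real k *\<^sub>R v \<le> u" for k using D0[of "u - real k *\<^sub>R v"] by simp
    then have "v = 0" using v0 by (intro archimedean_cone)
    then show ?thesis by (simp add: v_def le_zero_iff_zero_pprt)
  qed
  have "decreasing_to_zero D (\<lambda>a b. b \<le> a) (\<lambda>y. y)"
    unfolding decreasing_to_zero_def using D0 null by blast
  from dir this show "order_conv (\<lambda>n. inf \<bar>x n\<bar> u) 0 sequentially"
  proof (rule order_conv_any_index)
    fix y assume "y \<in> D"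
    then show "\<forall>\<^sub>F n in sequentially. \<bar>inf \<bar>x n\<bar> u - 0\<bar> \<le> y"
      using w0 unfolding D_def eventually_sequentially by (simp add: w_def)
  qed
qed

lemma bounded_partial_sums_imp_null:
  fixes a :: "nat \<Rightarrow> real"
  assumes "\<And>n. 0 \<le> a n" "\<And>n. (\<Sum>i<n. a i) \<le> C"
  shows "a \<longlonglongrightarrow> 0"
  using assms by (intro summable_LIMSEQ_zero summableI_nonneg_bounded)

text \<open>
  The truncations are disjoint and lie below \<open>u\<close>, so a positive functional has summable values on
  them.
\<close>
lemma disjoint_seq_uaw_null:
  fixes x :: "nat \<Rightarrow> 'a::banach_lattice"
  assumes disj: "disjoint_on UNIV x"
  shows "uaw_null x sequentially"
  unfolding uaw_null_def weakly_null_def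
proof (intro allI impI)
  fix u :: 'a and g :: "'a \<Rightarrow> real" assume u: "0 \<le> u" and g: "bounded_linear g"
  define w where "w n = inf \<bar>x n\<bar> u" for n
  have w0: "0 \<le> w n" and wu: "w n \<le> u" for n using u by (simp_all add: w_def)
  have wdisj: "inf (w m) (w n) = 0" if "m \<noteq> n" for m n
  proof -
    have "inf \<bar>x m\<bar> \<bar>x n\<bar> = 0" using disj that unfolding disjoint_on_def by blast
    from disjoint_mono[OF this w0 w0] show ?thesis by (simp add: w_def)
  qed
  interpret P: bounded_linear "dual_abs g" by (rule bounded_linear_dual_abs[OF g])
  have "(\<lambda>n. dual_abs g (w n)) \<longlonglongrightarrow> 0"
  proof (rule bounded_partial_sums_imp_null)
    show "0 \<le> dual_abs g (w n)" for n using nonneg_dual_abs[OF g] w0 by (simp add: dual_le_def)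
    show "(\<Sum>i<n. dual_abs g (w i)) \<le> dual_abs g u" for n
      using positive_functional_mono[OF P.linear nonneg_dual_abs[OF g] disjoint_sum_le[OF w0 wu u wdisj]]
      by (simp add: P.sum)
  qed
  then show "(\<lambda>n. g (inf \<bar>x n\<bar> u)) \<longlonglongrightarrow> 0"
    by (rule Lim_null_comparison[rotated])
      (use w0 in \<open>auto simp: w_def[symmetric] intro!: always_eventually le_dual_abs[OF g]\<close>)
qed

lemma un_null_imp_uaw_null:
  fixes x :: "'i \<Rightarrow> 'a::banach_lattice"
  assumes "un_null x F"
  shows "uaw_null x F"
  unfolding uaw_null_def weakly_null_def
proof (intro allI impI)
  fix u :: 'a and g :: "'a \<Rightarrow> real" assume "0 \<le> u" and g: "bounded_linear g"
  then have "((\<lambda>i. inf \<bar>x i\<bar> u) \<longlongrightarrow> 0) F" using assms by (simp add: un_null_def)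
  then show "((\<lambda>i. g (inf \<bar>x i\<bar> u)) \<longlongrightarrow> 0) F" by (rule bounded_linear.tendsto_zero[OF g])
qed

lemma uo_null_imp_un_null:
  fixes x :: "'i \<Rightarrow> 'a::banach_lattice"
  assumes oc: "order_continuous_norm TYPE('a)" and uo: "uo_null x F"
  shows "un_null x F"
  unfolding un_null_def
proof (intro allI impI tendstoI)
  fix u :: 'a and e :: real assume u: "0 \<le> u" and e: "0 < e"
  have "order_conv (\<lambda>i. inf \<bar>x i\<bar> u) 0 F" using uo u by (simp add: uo_null_def)
  then obtain J le and y :: "'a net_index \<Rightarrow> 'a" where
    y: "directed_set J le" "decreasing_to_zero J le y"
      "\<forall>\<beta>\<in>J. \<forall>\<^sub>F i in F. \<bar>inf \<bar>x i\<bar> u - 0\<bar> \<le> y \<beta>"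
    unfolding order_conv_def by blast
  have "((\<lambda>\<beta>. norm (y \<beta>)) \<longlongrightarrow> 0) (tails J le)"
    using oc y(1,2) unfolding order_continuous_norm_def by blast
  from eventually_tails_witness[OF y(1) tendstoD[OF this e]]
  obtain b where b: "b \<in> J" "norm (y b) < e" by auto
  from y(3)[rule_format, OF b(1)]
  show "\<forall>\<^sub>F i in F. dist (inf \<bar>x i\<bar> u) 0 < e"
  proof eventually_elim
    case (elim i)
    then show ?case
      using norm_mono_cone[OF abs_ge_zero elim] b(2) by simp
  qed
qed

section \<open>Uniform truncation\<close>

text \<open>
  The element \<open>x - inf x u\<close> is the positive part of \<open>x - u\<close>.  This is the property through which
  all conditions of the theorem are compared.
\<close>
definition uniformly_truncates :: "('a::banach_lattice \<Rightarrow> real) \<Rightarrow> bool" where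
  "uniformly_truncates p \<longleftrightarrow>
     (\<forall>M. \<forall>e>0. \<exists>u\<ge>0. \<forall>x\<ge>0. norm x \<le> M \<longrightarrow> p (x - inf x u) \<le> e)"

text \<open>
  Disjointification.  If truncation fails for \<open>M\<close> and \<open>e\<close>, there are \<open>x n \<ge> 0\<close> of norm at most \<open>M\<close> such
  that \<open>p\<close> exceeds \<open>e\<close> on the positive part of \<open>x n - 4 ^ n *\<^sub>R s n\<close>, where \<open>s n\<close> is the sum of the
  earlier terms.  Subtract in addition \<open>u / 2 ^ n\<close>, where \<open>u\<close> is the sum of all \<open>x n / 2 ^ n\<close>.  The
  resulting positive parts \<open>z n\<close> are pairwise disjoint: for \<open>m < n\<close>, the first subtraction takes
  \<open>4 ^ n *\<^sub>R x m\<close> off \<open>x n\<close> and the second takes at least \<open>x n / 4 ^ n\<close> off \<open>x m\<close>.  The second lowers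
  the value of \<open>p\<close> by at most \<open>p u / 2 ^ n\<close>, so \<open>p (z n)\<close> does not tend to zero.
\<close>
lemma uniformly_truncates_if_disjoint_null:
  fixes p :: "'a::banach_lattice \<Rightarrow> real"
  assumes p: "bounded_linear p" "dual_le (\<lambda>_. 0) p"
    and null: "\<And>z. bounded (range z) \<Longrightarrow> (\<And>n. 0 \<le> z n) \<Longrightarrow>
      (\<And>m n. m < n \<Longrightarrow> inf (z m) (z n) = 0) \<Longrightarrow> (\<lambda>n::nat. p (z n)) \<longlonglongrightarrow> 0"
  shows "uniformly_truncates p"
proof (rule ccontr)
  interpret p: bounded_linear p by (rule p)
  assume "\<not> uniformly_truncates p"
  then obtain M e where e: "0 < e"
    and "\<forall>u\<ge>0. \<exists>x\<ge>0. norm x \<le> M \<and> e < p (x - inf x u)"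
    unfolding uniformly_truncates_def by (auto simp: not_le)
  then obtain X where X: "\<And>u. 0 \<le> u \<Longrightarrow> 0 \<le> X u" "\<And>u. 0 \<le> u \<Longrightarrow> norm (X u) \<le> M"
    "\<And>u. 0 \<le> u \<Longrightarrow> e < p (pprt (X u - u))"
    unfolding diff_inf_eq_pprt by metis
  \<comment> \<open>\<open>s n\<close> is the sum of the elements chosen before stage \<open>n\<close>.\<close>
  define s where "s = rec_nat (0::'a) (\<lambda>n t. t + X (4 ^ n *\<^sub>R t))"
  define x where "x n = X (4 ^ n *\<^sub>R s n)" for n
  have s_simps: "s 0 = 0" "s (Suc n) = s n + x n" for n by (simp_all add: s_def x_def)
  have s0: "0 \<le> s n" for n
    by (induction n) (simp_all add: s_simps x_def X(1) scaleR_nonneg_nonneg)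
  then have x0: "0 \<le> x n" and xM: "norm (x n) \<le> M" and xe: "e < p (pprt (x n - 4 ^ n *\<^sub>R s n))" for n
    unfolding x_def by (simp_all add: X scaleR_nonneg_nonneg)
  have x_le_s: "x m \<le> s n" if "m < n" for m n
    using that
  proof (induction n)
    case (Suc n)
    then show ?case
      using s0[of n] x0[of n] by (cases "m = n") (simp_all add: s_simps add_increasing2)
  qed simp
  define w where "w n = (1 / 2 ^ n) *\<^sub>R x n" for n
  have w0: "0 \<le> w n" for n using x0 by (simp add: w_def scaleR_nonneg_nonneg)
  have "norm (w n) \<le> M * (1 / 2) ^ n" for n
    using xM[of n] by (simp add: w_def power_one_over divide_right_mono)
  then have sum: "summable w"
    by (intro summable_comparison_test[of w "\<lambda>n. M * (1 / 2) ^ n"])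
      (auto intro: summable_mult summable_geometric)
  define u where "u = suminf w"
  have wu: "w n \<le> u" for n unfolding u_def by (rule term_le_suminf_cone[OF sum w0])
  have u0: "0 \<le> u" using order_trans[OF w0 wu] .
  define z where "z n = pprt (x n - 4 ^ n *\<^sub>R s n - (1 / 2 ^ n) *\<^sub>R u)" for n
  have sub0: "0 \<le> 4 ^ n *\<^sub>R s n" "0 \<le> (1 / 2 ^ n) *\<^sub>R u" for n
    using s0 u0 by (simp_all add: scaleR_nonneg_nonneg)
  have z0: "0 \<le> z n" for n by (simp add: z_def)
  have z_disj: "inf (z m) (z n) = 0" if mn: "m < n" for m n
  proof -
    \<comment> \<open>\<open>u\<close> majorises \<open>x n / 2 ^ n\<close>, and \<open>m + n \<le> 2 * n\<close>.\<close>
    have "(1 / 4 ^ n) *\<^sub>R x n \<le> (1 / 2 ^ m * (1 / 2 ^ n)) *\<^sub>R x n"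
    proof (rule scaleR_right_mono[OF _ x0])
      have "(2::real) ^ (m + n) \<le> 2 ^ (2 * n)" using mn by (intro power_increasing) simp_all
      then show "(1::real) / 4 ^ n \<le> 1 / 2 ^ m * (1 / 2 ^ n)"
        by (simp add: frac_le power_mult power_add)
    qed
    also have "\<dots> \<le> (1 / 2 ^ m) *\<^sub>R u"
      using scaleR_left_mono[OF wu[of n], of "1 / 2 ^ m"] by (simp add: w_def)
    finally have "x m - (1 / 2 ^ m) *\<^sub>R u \<le> x m - (1 / 4 ^ n) *\<^sub>R x n" by simp
    moreover have "x m - 4 ^ m *\<^sub>R s m - (1 / 2 ^ m) *\<^sub>R u \<le> x m - (1 / 2 ^ m) *\<^sub>R u"
      using sub0 by simp
    ultimately have zm: "z m \<le> pprt (x m - (1 / 4 ^ n) *\<^sub>R x n)"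
      unfolding z_def by (intro pprt_mono) (rule order_trans)
    have "x n - 4 ^ n *\<^sub>R s n - (1 / 2 ^ n) *\<^sub>R u \<le> x n - 4 ^ n *\<^sub>R s n"
      using sub0 by simp
    also have "\<dots> \<le> x n - 4 ^ n *\<^sub>R x m"
      using x_le_s[OF mn] by (simp add: scaleR_left_mono)
    finally have zn: "z n \<le> pprt (x n - 4 ^ n *\<^sub>R x m)"
      unfolding z_def by (rule pprt_mono)
    show ?thesis
      by (rule disjoint_mono[OF disjoint_prts_scaled z0 z0 zm zn]) (simp_all add: x0)
  qed
  have "norm (z n) \<le> M" for n
  proof -
    have "x n - 4 ^ n *\<^sub>R s n - (1 / 2 ^ n) *\<^sub>R u \<le> x n"
      using add_nonneg_nonneg[OF sub0, of n n]
      by (simp only: diff_diff_eq diff_le_eq le_add_same_cancel1)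
    then have "z n \<le> x n" using x0 by (simp add: z_def pprt_def)
    with xM[of n] norm_mono_cone[OF z0, of n "x n"] show ?thesis by linarith
  qed
  then have "bounded (range z)" by (auto simp: bounded_iff)
  then have "(\<lambda>n. p (z n)) \<longlonglongrightarrow> 0" by (rule null[OF _ z0 z_disj])
  moreover have "(\<lambda>n. (1 / 2 ^ n) * p u) \<longlonglongrightarrow> 0"
    using tendsto_mult_left_zero[OF LIMSEQ_power_zero[of "1 / 2 :: real"]]
    by (simp add: power_one_over)
  ultimately have "(\<lambda>n. p (z n) + (1 / 2 ^ n) * p u) \<longlonglongrightarrow> 0" by (rule tendsto_add_zero)
  moreover have "e \<le> p (z n) + (1 / 2 ^ n) * p u" for n
  proof -
    have "pprt (x n - 4 ^ n *\<^sub>R s n) \<le> z n + (1 / 2 ^ n) *\<^sub>R u"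
      using sub0[of n] by (simp add: z_def pprt_def add_sup_distrib_right le_supI1 le_supI2)
    then have "p (pprt (x n - 4 ^ n *\<^sub>R s n)) \<le> p (z n + (1 / 2 ^ n) *\<^sub>R u)"
      by (rule positive_functional_mono[OF p.linear p(2)])
    then show ?thesis using xe[of n] by (simp add: p.add p.scaleR)
  qed
  ultimately have "e \<le> 0" by (intro LIMSEQ_le_const) auto
  with e show False by simp
qed

text \<open>
  Passage from \<open>f\<close> to its modulus: elements \<open>y n\<close> with \<open>\<bar>y n\<bar> \<le> z n\<close> that almost attain
  \<open>dual_abs f (z n)\<close> are again disjoint and bounded.
\<close>
lemma truncates_if_null_on_disjoint:
  fixes f :: "'a::banach_lattice \<Rightarrow> real"
  assumes f: "bounded_linear f"
    and null: "\<And>x. bounded (range x) \<Longrightarrow> disjoint_on UNIV x \<Longrightarrow> (\<lambda>n::nat. f (x n)) \<longlonglongrightarrow> 0"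
  shows "uniformly_truncates (dual_abs f)"
proof (rule uniformly_truncates_if_disjoint_null)
  fix z :: "nat \<Rightarrow> 'a"
  assume bdd: "bounded (range z)" and z0: "\<And>n. 0 \<le> z n"
    and disj: "\<And>m n. m < n \<Longrightarrow> inf (z m) (z n) = 0"
  have "\<exists>y. \<bar>y\<bar> \<le> z n \<and> dual_abs f (z n) - 1 / real (Suc n) < f y" for n
    by (rule dual_abs_approx[OF f z0]) simp
  then obtain y where y: "\<And>n. \<bar>y n\<bar> \<le> z n"
    "\<And>n. dual_abs f (z n) - 1 / real (Suc n) < f (y n)" by metis
  obtain M where M: "\<And>n. norm (z n) \<le> M" using bdd by (auto simp: bounded_iff)
  have "norm (y n) \<le> M" for n
    using norm_mono_cone[OF abs_ge_zero y(1)[of n]] M[of n] by simp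
  then have "bounded (range y)" by (auto simp: bounded_iff)
  moreover have "inf (z m) (z n) = 0" if "m \<noteq> n" for m n
    using disj[of m n] disj[of n m] that by (cases "m < n") (simp_all add: inf_commute)
  then have "disjoint_on UNIV y"
    unfolding disjoint_on_def using y(1) by (blast intro: disjoint_mono abs_ge_zero)
  ultimately have "(\<lambda>n. f (y n)) \<longlonglongrightarrow> 0" by (rule null)
  from tendsto_add[OF this LIMSEQ_inverse_real_of_nat]
  have lim: "(\<lambda>n. f (y n) + 1 / real (Suc n)) \<longlonglongrightarrow> 0" by (simp add: inverse_eq_divide)
  have "0 \<le> dual_abs f (z n)" for n using nonneg_dual_abs[OF f] z0 by (simp add: dual_le_def)
  moreover have "dual_abs f (z n) \<le> f (y n) + 1 / real (Suc n)" for n using y(2)[of n] by simp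
  ultimately show "(\<lambda>n. dual_abs f (z n)) \<longlonglongrightarrow> 0"
    by (intro tendsto_sandwich[OF _ _ tendsto_const lim]) auto
qed (use f bounded_linear_dual_abs nonneg_dual_abs in auto)

text \<open>
  The element is split into positive and negative part before it is truncated, so that the
  hypotheses concern \<open>f\<close> itself and its order continuity can be applied to them; the modulus only
  bounds the two remainders.
\<close>
lemma null_if_truncations_null:
  fixes f :: "'a::banach_lattice \<Rightarrow> real" and x :: "'i \<Rightarrow> 'a"
  assumes f: "bounded_linear f" and trunc: "uniformly_truncates (dual_abs f)"
    and bdd: "\<forall>\<^sub>F i in F. norm (x i) \<le> M"
    and pos: "\<And>u. 0 \<le> u \<Longrightarrow> ((\<lambda>i. f (inf (pprt (x i)) u)) \<longlongrightarrow> 0) F"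
    and neg: "\<And>u. 0 \<le> u \<Longrightarrow> ((\<lambda>i. f (inf (pprt (- x i)) u)) \<longlongrightarrow> 0) F"
  shows "((\<lambda>i. f (x i)) \<longlongrightarrow> 0) F"
proof (rule tendstoI)
  interpret f: bounded_linear f by (rule f)
  fix e :: real assume "0 < e"
  then have e: "0 < e / 4" by simp
  obtain u where u: "0 \<le> u"
    "\<And>y. 0 \<le> y \<Longrightarrow> norm y \<le> M \<Longrightarrow> dual_abs f (y - inf y u) \<le> e / 4"
    using trunc e unfolding uniformly_truncates_def by meson
  have rest: "\<bar>f (y - inf y u)\<bar> \<le> e / 4" if "0 \<le> y" "norm y \<le> M" for y
  proof -
    have "\<bar>y - inf y u\<bar> \<le> y - inf y u" by (simp only: abs_of_nonneg diff_ge_0_iff_ge inf_le1 order_refl)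
    then show ?thesis using le_dual_abs[OF f] u(2)[OF that] by (blast intro: order_trans)
  qed
  show "\<forall>\<^sub>F i in F. dist (f (x i)) 0 < e"
    using bdd tendstoD[OF pos[OF u(1)] e] tendstoD[OF neg[OF u(1)] e]
  proof eventually_elim
    case (elim i)
    let ?a = "pprt (x i)" and ?b = "pprt (- x i)"
    have "norm ?a \<le> M" "norm ?b \<le> M"
      using norm_mono_cone[OF zero_le_pprt pprt_le_abs(1), of "x i"]
        norm_mono_cone[OF zero_le_pprt pprt_le_abs(2), of "x i"] elim(1) by simp_all
    then have "\<bar>f (?a - inf ?a u)\<bar> \<le> e / 4" "\<bar>f (?b - inf ?b u)\<bar> \<le> e / 4"
      by (blast intro: rest zero_le_pprt)+
    moreover have "f (x i) = f ?a - f ?b" by (simp add: f.diff[symmetric] flip: pprt_split(1))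
    ultimately show ?case using elim(2,3) unfolding f.diff dist_real_def by linarith
  qed
qed

lemma inf_prt_le:
  fixes x :: "'a::banach_lattice"
  assumes "0 \<le> u"
  shows "\<bar>inf (pprt x) u\<bar> \<le> inf \<bar>x\<bar> u" "\<bar>inf (pprt (- x)) u\<bar> \<le> inf \<bar>x\<bar> u"
proof -
  have "\<bar>inf (pprt y) u\<bar> = inf (pprt y) u" for y using assms by simp
  then show "\<bar>inf (pprt x) u\<bar> \<le> inf \<bar>x\<bar> u" "\<bar>inf (pprt (- x)) u\<bar> \<le> inf \<bar>x\<bar> u"
    using inf_mono[OF pprt_le_abs(1) order_refl] inf_mono[OF pprt_le_abs(2) order_refl] by simp_all
qed

lemma uaw_null_imp_null:
  fixes f :: "'a::banach_lattice \<Rightarrow> real"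
  assumes f: "bounded_linear f" and trunc: "uniformly_truncates (dual_abs f)"
    and bdd: "\<forall>\<^sub>F i in F. norm (x i) \<le> M" and uaw: "uaw_null x F"
  shows "((\<lambda>i. f (x i)) \<longlongrightarrow> 0) F"
proof (rule null_if_truncations_null[OF f trunc bdd])
  fix u :: 'a assume u: "0 \<le> u"
  have lim: "((\<lambda>i. dual_abs f (inf \<bar>x i\<bar> u)) \<longlongrightarrow> 0) F"
    using uaw u bounded_linear_dual_abs[OF f] unfolding uaw_null_def weakly_null_def by blast
  show "((\<lambda>i. f (inf (pprt (x i)) u)) \<longlongrightarrow> 0) F"
    by (rule Lim_null_comparison[OF always_eventually lim])
      (simp add: le_dual_abs[OF f inf_prt_le(1)[OF u]])
  show "((\<lambda>i. f (inf (pprt (- x i)) u)) \<longlongrightarrow> 0) F"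
    by (rule Lim_null_comparison[OF always_eventually lim])
      (simp add: le_dual_abs[OF f inf_prt_le(2)[OF u]])
qed

lemma order_conv_zero_mono:
  fixes x z :: "'i \<Rightarrow> 'a::banach_lattice"
  assumes "order_conv x 0 F" "\<And>i. \<bar>z i\<bar> \<le> x i"
  shows "order_conv z 0 F"
proof -
  have "\<bar>z i - 0\<bar> \<le> y" if "\<bar>x i - 0\<bar> \<le> y" for y i
    using order_trans[OF order_trans[OF assms(2) abs_ge_self]] that by simp
  then have mono: "\<forall>\<^sub>F i in F. \<bar>z i - 0\<bar> \<le> y" if "\<forall>\<^sub>F i in F. \<bar>x i - 0\<bar> \<le> y" for y
    by (rule eventually_mono[OF that])
  obtain J le and y :: "'a net_index \<Rightarrow> 'a" where
    "directed_set J le" "decreasing_to_zero J le y"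
    "\<forall>\<beta>\<in>J. \<forall>\<^sub>F i in F. \<bar>x i - 0\<bar> \<le> y \<beta>"
    using assms(1) unfolding order_conv_def by blast
  with mono show ?thesis by (blast intro: order_conv_any_index)
qed

lemma uo_null_imp_null:
  fixes f :: "'a::banach_lattice \<Rightarrow> real"
  assumes f: "f \<in> order_cont_dual" and trunc: "uniformly_truncates (dual_abs f)"
    and dir: "directed_set I le"
    and bdd: "\<forall>\<^sub>F i in tails I le. norm (x i) \<le> M" and uo: "uo_null x (tails I le)"
  shows "((\<lambda>i. f (x i)) \<longlongrightarrow> 0) (tails I le)"
proof (rule null_if_truncations_null[OF order_cont_imp_bounded_linear[OF f] trunc bdd])
  fix u :: 'a assume u: "0 \<le> u"
  then have "order_conv (\<lambda>i. inf \<bar>x i\<bar> u) 0 (tails I le)" using uo by (simp add: uo_null_def)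
  note oc = order_conv_zero_mono[OF this]
  show "((\<lambda>i. f (inf (pprt (x i)) u)) \<longlongrightarrow> 0) (tails I le)"
    by (rule order_cont_dual_any_index[OF f dir oc[OF inf_prt_le(1)[OF u]]])
  show "((\<lambda>i. f (inf (pprt (- x i)) u)) \<longlongrightarrow> 0) (tails I le)"
    by (rule order_cont_dual_any_index[OF f dir oc[OF inf_prt_le(2)[OF u]]])
qed

text \<open>
  On the unit ball \<open>g n\<close> is at most \<open>e / 3 + g n u\<close>, with one \<open>u\<close> for all \<open>n\<close>, and \<open>g n u\<close> tends to
  zero because its partial sums are bounded by \<open>p u\<close>.
\<close>
lemma disjoint_functionals_norm_null:
  fixes p :: "'a::banach_lattice \<Rightarrow> real" and g :: "nat \<Rightarrow> 'a \<Rightarrow> real"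
  assumes p: "bounded_linear p" "dual_le (\<lambda>_. 0) p" and trunc: "uniformly_truncates p"
    and g: "range g \<subseteq> dual_interval (\<lambda>_. 0) p" and disj: "dual_disjoint_seq g"
  shows "(\<lambda>n. onorm (g n)) \<longlonglongrightarrow> 0"
proof (rule tendstoI)
  fix e :: real assume "0 < e"
  then have e: "0 < e / 3" by simp
  have g_lin: "bounded_linear (g n)" and g_pos: "dual_le (\<lambda>_. 0) (g n)" and g_le: "dual_le (g n) p"
    for n using g unfolding dual_interval_def by auto
  have split: "dual_splits (g m) (g n)" if "m \<noteq> n" for m n
    using disj that unfolding dual_disjoint_seq_def
    by (simp add: dual_abs_of_nonneg g_lin g_pos dual_inf_zero_iff_splits)
  obtain u where u: "0 \<le> u" "\<And>x. 0 \<le> x \<Longrightarrow> norm x \<le> 1 \<Longrightarrow> p (x - inf x u) \<le> e / 3"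
    using trunc e unfolding uniformly_truncates_def by meson
  have "(\<lambda>n. g n u) \<longlonglongrightarrow> 0"
  proof (rule bounded_partial_sums_imp_null)
    show "0 \<le> g n u" for n using g_pos[of n] u(1) by (simp add: dual_le_def)
    have "dual_le (\<lambda>x. \<Sum>i<n. g i x) p" for n
      by (rule disjoint_functionals_sum_le[OF _ g_pos g_le _ p(2) split])
        (simp_all add: bounded_linear.linear g_lin p(1))
    then show "(\<Sum>i<n. g i u) \<le> p u" for n using u(1) by (simp add: dual_le_def)
  qed
  from tendstoD[OF this e]
  show "\<forall>\<^sub>F n in sequentially. dist (onorm (g n)) 0 < e"
  proof eventually_elim
    case (elim n)
    interpret gn: bounded_linear "g n" by (rule g_lin)
    have unit: "g n x \<le> 2 * (e / 3)" if x: "0 \<le> x" "norm x \<le> 1" for x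
    proof -
      have "0 \<le> x - inf x u" by (simp only: diff_ge_0_iff_ge inf_le1)
      then have "g n (x - inf x u) \<le> p (x - inf x u)" using g_le[of n] by (simp only: dual_le_def)
      moreover have "g n (inf x u) \<le> g n u"
        by (rule positive_functional_mono[OF gn.linear g_pos inf_le2])
      moreover have "g n x = g n (x - inf x u) + g n (inf x u)"
        by (simp only: gn.add[symmetric] diff_add_cancel)
      ultimately show ?thesis using elim u(2)[OF x] unfolding dist_real_def by linarith
    qed
    have "onorm (g n) \<le> 2 * (e / 3)"
    proof (rule onorm_bound)
      fix x
      have "g n ((1 / norm x) *\<^sub>R \<bar>x\<bar>) \<le> 2 * (e / 3)"
        by (rule unit) (simp_all add: scaleR_nonneg_nonneg)
      then have "g n \<bar>x\<bar> \<le> 2 * (e / 3) * norm x"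
        by (cases "x = 0") (simp_all add: gn.scaleR gn.zero pos_divide_le_eq)
      moreover have "\<bar>g n x\<bar> \<le> g n \<bar>x\<bar>"
        using le_dual_abs[OF g_lin, of x "\<bar>x\<bar>" n] by (simp add: dual_abs_of_nonneg g_lin g_pos)
      ultimately show "norm (g n x) \<le> 2 * (e / 3) * norm x" by simp
    qed (use \<open>0 < e\<close> in simp)
    then show ?case using onorm_pos_le[OF g_lin, of n] \<open>0 < e\<close> by simp
  qed
qed

section \<open>Components of a functional\<close>

text \<open>
  On the positive cone this is the part of a positive functional \<open>p\<close> carried by the ideal
  generated by \<open>w\<close>: it vanishes at elements disjoint from \<open>w\<close> and agrees with \<open>p\<close> at \<open>w\<close>.
\<close>
definition band_component :: "('a::banach_lattice \<Rightarrow> real) \<Rightarrow> 'a \<Rightarrow> 'a \<Rightarrow> real" where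
  "band_component p w x = (SUP k. p (inf x (real k *\<^sub>R w)))"

context
  fixes p :: "'a::banach_lattice \<Rightarrow> real" and w :: 'a
  assumes p: "bounded_linear p" "dual_le (\<lambda>_. 0) p" and w: "0 \<le> w"
begin

lemma band_component_upper: "p (inf x (real k *\<^sub>R w)) \<le> band_component p w x"
  unfolding band_component_def
proof (rule cSUP_upper)
  show "bdd_above (range (\<lambda>k. p (inf x (real k *\<^sub>R w))))"
    by (intro bdd_aboveI[of _ "p x"])
      (auto intro: positive_functional_mono[OF bounded_linear.linear[OF p(1)] p(2)])
qed simp

lemma band_component_least:
  assumes "\<And>k. p (inf x (real k *\<^sub>R w)) \<le> c"
  shows "band_component p w x \<le> c"
  unfolding band_component_def by (rule cSUP_least) (simp_all add: assms)

lemma band_component_le: "band_component p w x \<le> p x"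
  by (rule band_component_least)
    (rule positive_functional_mono[OF bounded_linear.linear[OF p(1)] p(2) inf_le1])

lemma band_component_nonneg: "0 \<le> x \<Longrightarrow> 0 \<le> band_component p w x"
  using band_component_upper[of x 0] by (simp add: inf_absorb2 linear_0[OF bounded_linear.linear[OF p(1)]])

text \<open>
  The two inequalities come from subadditivity of truncation at \<open>k *\<^sub>R w\<close> and from
  \<open>inf x (k *\<^sub>R w) + inf y (l *\<^sub>R w) \<le> inf (x + y) ((k + l) *\<^sub>R w)\<close>.
\<close>
lemma band_component_add:
  assumes xy: "0 \<le> x" "0 \<le> y"
  shows "band_component p w (x + y) = band_component p w x + band_component p w y"
proof (rule antisym)
  interpret p: bounded_linear p by (rule p)
  note mono = positive_functional_mono[OF p.linear p(2)]
  have kw: "0 \<le> real k *\<^sub>R w" for k using w by (simp add: scaleR_nonneg_nonneg)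
  show "band_component p w (x + y) \<le> band_component p w x + band_component p w y"
  proof (rule band_component_least)
    fix k
    have "p (inf (x + y) (real k *\<^sub>R w)) \<le> p (inf x (real k *\<^sub>R w) + inf y (real k *\<^sub>R w))"
      by (rule mono[OF inf_add_le[OF xy kw]])
    also have "\<dots> \<le> band_component p w x + band_component p w y"
      by (simp add: p.add add_mono band_component_upper)
    finally show "p (inf (x + y) (real k *\<^sub>R w)) \<le> band_component p w x + band_component p w y" .
  qed
  have "p (inf x (real k *\<^sub>R w)) + p (inf y (real l *\<^sub>R w)) \<le> band_component p w (x + y)" for k l
  proof -
    have "inf x (real k *\<^sub>R w) + inf y (real l *\<^sub>R w) \<le> inf (x + y) (real (k + l) *\<^sub>R w)"
      by (simp add: add_mono scaleR_add_left)
    from order_trans[OF mono[OF this] band_component_upper] show ?thesis by (simp add: p.add)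
  qed
  then have "p (inf x (real k *\<^sub>R w)) \<le> band_component p w (x + y) - band_component p w y" for k
    using band_component_least[of y "band_component p w (x + y) - p (inf x (real k *\<^sub>R w))"]
    by (simp add: le_diff_eq add.commute)
  from band_component_least[OF this]
  show "band_component p w x + band_component p w y \<le> band_component p w (x + y)" by simp
qed

lemma band_component_functional:
  obtains g where "bounded_linear g" "dual_le (\<lambda>_. 0) g" "dual_le g p"
    "\<And>x. 0 \<le> x \<Longrightarrow> g x = band_component p w x"
proof -
  obtain K where K: "0 \<le> K" "\<And>x. norm (p x) \<le> norm x * K"
    using bounded_linear.nonneg_bounded[OF p(1)] by blast
  have "band_component p w x \<le> K * norm x" for x
    using band_component_le[of x] K(2)[of x] by (simp add: mult.commute)
  then obtain g where g: "bounded_linear g" "\<And>x. 0 \<le> x \<Longrightarrow> g x = band_component p w x"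
    using functional_on_cone_extends[of "band_component p w" K] band_component_add
      band_component_nonneg K(1) by metis
  moreover have "dual_le (\<lambda>_. 0) g" "dual_le g p"
    using g(2) band_component_nonneg band_component_le by (simp_all add: dual_le_def)
  ultimately show thesis using that by blast
qed

end

text \<open>
  The piece \<open>inf x (k *\<^sub>R v)\<close> of \<open>x\<close> is disjoint from \<open>w\<close>, hence annihilated by \<open>h\<close>, and for large
  \<open>k\<close> it carries almost all of \<open>g x\<close>.
\<close>
lemma band_components_split:
  fixes p :: "'a::banach_lattice \<Rightarrow> real"
  assumes p: "bounded_linear p" "dual_le (\<lambda>_. 0) p" and v: "0 \<le> v" and w: "0 \<le> w"
    and disj: "inf v w = 0" and g: "linear g" "\<And>x. 0 \<le> x \<Longrightarrow> g x = band_component p v x"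
    and h: "\<And>x. 0 \<le> x \<Longrightarrow> h x = band_component p w x"
  shows "dual_splits g h"
  unfolding dual_splits_def
proof (intro allI impI)
  fix x :: 'a and e :: real assume x: "0 \<le> x" and e: "0 < e"
  obtain k where k: "g x - e < p (inf x (real k *\<^sub>R v))"
  proof (rule ccontr)
    assume "\<not> thesis"
    then have "p (inf x (real k *\<^sub>R v)) \<le> g x - e" for k using that not_less by blast
    from band_component_least[OF p v this] show False using g(2)[OF x] e by simp
  qed
  define y where "y = inf x (real k *\<^sub>R v)"
  have y: "0 \<le> y" "y \<le> x" "y \<le> real k *\<^sub>R v"
    using x v by (simp_all add: y_def scaleR_nonneg_nonneg)
  have "p y \<le> g y"
    using band_component_upper[OF p v, of y k] y by (simp add: g(2) inf_absorb1)
  then have "g (x - y) < e" using k[folded y_def] by (simp add: linear_diff[OF g(1)])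
  moreover have "band_component p w y \<le> 0"
  proof (rule band_component_least[OF p w])
    fix l
    have "inf (real l *\<^sub>R w) v = 0"
      using disjoint_scale[OF _ w v, of "real l"] disj inf_commute[of v w] by simp
    then have "inf v (real l *\<^sub>R w) = 0" by (subst inf_commute)
    then have "inf (real k *\<^sub>R v) (real l *\<^sub>R w) = 0"
      using v w by (simp add: disjoint_scale scaleR_nonneg_nonneg)
    from disjoint_mono[OF this y(1) _ y(3) order_refl] w
    have "inf y (real l *\<^sub>R w) = 0" by (simp add: scaleR_nonneg_nonneg)
    then show "p (inf y (real l *\<^sub>R w)) \<le> 0"
      by (simp add: linear_0[OF bounded_linear.linear[OF p(1)]])
  qed
  then have "h (x - (x - y)) < e" using h[OF y(1)] e by simp
  ultimately show "\<exists>y. 0 \<le> y \<and> y \<le> x \<and> g y < e \<and> h (x - y) < e"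
    using y by (intro exI[of _ "x - y"]) simp
qed

text \<open>
  The components \<open>g n\<close> of the modulus along \<open>\<bar>x n\<bar>\<close> are disjoint, and
  \<open>\<bar>f (x n)\<bar> \<le> g n \<bar>x n\<bar> \<le> onorm (g n) * norm (x n)\<close>.
\<close>
lemma null_on_disjoint_if_disjoint_functionals_null:
  fixes f :: "'a::banach_lattice \<Rightarrow> real" and x :: "nat \<Rightarrow> 'a"
  assumes f: "bounded_linear f"
    and null: "\<And>g. range g \<subseteq> dual_interval (\<lambda>_. 0) (dual_abs f) \<Longrightarrow> dual_disjoint_seq g \<Longrightarrow>
      (\<lambda>n::nat. onorm (g n)) \<longlonglongrightarrow> 0"
    and bdd: "bounded (range x)" and disj: "disjoint_on UNIV x"
  shows "(\<lambda>n. f (x n)) \<longlonglongrightarrow> 0"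
proof -
  define p where "p = dual_abs f"
  have p: "bounded_linear p" "dual_le (\<lambda>_. 0) p"
    by (simp_all add: p_def bounded_linear_dual_abs nonneg_dual_abs f)
  have "\<exists>g. bounded_linear g \<and> dual_le (\<lambda>_. 0) g \<and> dual_le g p \<and>
      (\<forall>y\<ge>0. g y = band_component p \<bar>x n\<bar> y)" for n
    using band_component_functional[OF p abs_ge_zero, of "x n"] by metis
  then obtain g where g: "\<And>n. bounded_linear (g n)" "\<And>n. dual_le (\<lambda>_. 0) (g n)"
    "\<And>n. dual_le (g n) p" "\<And>n y. 0 \<le> y \<Longrightarrow> g n y = band_component p \<bar>x n\<bar> y"
    by metis
  have "is_dual_inf (g m) (g n) (\<lambda>_. 0)" if "m \<noteq> n" for m n
  proof -
    have "inf \<bar>x m\<bar> \<bar>x n\<bar> = 0" using disj that unfolding disjoint_on_def by blast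
    from band_components_split[OF p abs_ge_zero abs_ge_zero this bounded_linear.linear[OF g(1)] g(4) g(4)]
    show ?thesis by (simp add: dual_inf_zero_iff_splits g)
  qed
  then have "dual_disjoint_seq g"
    unfolding dual_disjoint_seq_def by (simp add: dual_abs_of_nonneg g)
  moreover have "range g \<subseteq> dual_interval (\<lambda>_. 0) (dual_abs f)"
    using g by (auto simp: dual_interval_def p_def[symmetric])
  ultimately have lim: "(\<lambda>n. onorm (g n)) \<longlonglongrightarrow> 0" by (rule null[rotated])
  obtain M where M: "\<And>n. norm (x n) \<le> M" using bdd by (auto simp: bounded_iff)
  have "\<bar>f (x n)\<bar> \<le> onorm (g n) * M" for n
  proof -
    have "\<bar>f (x n)\<bar> \<le> p \<bar>x n\<bar>" unfolding p_def by (rule le_dual_abs[OF f order_refl])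
    also have "\<dots> \<le> g n \<bar>x n\<bar>"
      using band_component_upper[OF p abs_ge_zero, of "\<bar>x n\<bar>" 1 "x n"] by (simp add: g(4))
    also have "\<dots> \<le> onorm (g n) * norm (x n)" using onorm[OF g(1), of n "\<bar>x n\<bar>"] by simp
    also have "\<dots> \<le> onorm (g n) * M" by (rule mult_left_mono[OF M onorm_pos_le[OF g(1)]])
    finally show ?thesis .
  qed
  then show ?thesis
    by (intro Lim_null_comparison[OF always_eventually tendsto_mult_left_zero[OF lim, of M]]) simp
qed

section \<open>The equivalence\<close>

text \<open>
  For a disjoint net, only finitely many indices can have \<open>\<bar>f (x i)\<bar> \<ge> e\<close>, since infinitely many
  would contain a disjoint sequence.  A directed set without greatest element leaves every finite
  set of indices behind.
\<close>
lemma disjoint_dual_iff_sequences: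
  fixes f :: "'a::banach_lattice \<Rightarrow> real"
  assumes f: "bounded_linear f"
  shows "f \<in> disjoint_dual \<longleftrightarrow>
    (\<forall>x :: nat \<Rightarrow> 'a. bounded (range x) \<longrightarrow> disjoint_on UNIV x \<longrightarrow> (\<lambda>n. f (x n)) \<longlonglongrightarrow> 0)"
proof (intro iffI allI impI)
  fix x :: "nat \<Rightarrow> 'a"
  assume "f \<in> disjoint_dual" "bounded (range x)" "disjoint_on UNIV x"
  moreover have "\<not> (\<exists>m\<in>UNIV. \<forall>i\<in>UNIV. i \<le> (m::nat))" using Suc_n_not_le_n by blast
  ultimately show "(\<lambda>n. f (x n)) \<longlonglongrightarrow> 0"
    using disjoint_dual_any_index[OF _ directed_set_nat, of f x] by (simp add: tails_nat)
next
  assume null: "\<forall>x :: nat \<Rightarrow> 'a. bounded (range x) \<longrightarrow> disjoint_on UNIV x \<longrightarrow>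
    (\<lambda>n. f (x n)) \<longlonglongrightarrow> 0"
  have "((\<lambda>i. f (x i)) \<longlongrightarrow> 0) (tails I le)"
    if dir: "directed_set I le" and nomax: "\<not> (\<exists>m\<in>I. \<forall>i\<in>I. le i m)"
      and bdd: "bounded (x ` I)" and disj: "disjoint_on I x" for I le and x :: "'a net_index \<Rightarrow> 'a"
  proof (rule tendstoI)
    fix e :: real assume e: "0 < e"
    define S where "S = {i\<in>I. e \<le> \<bar>f (x i)\<bar>}"
    have "finite S"
    proof (rule ccontr)
      assume "infinite S"
      then obtain s :: "nat \<Rightarrow> 'a net_index" where s: "inj s" "range s \<subseteq> S"
        using infinite_countable_subset by blast
      then have sI: "s n \<in> I" and big: "e \<le> \<bar>f (x (s n))\<bar>" for n unfolding S_def by auto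
      have "bounded (range (\<lambda>n. x (s n)))" using sI by (auto intro: bounded_subset[OF bdd])
      moreover have "disjoint_on UNIV (\<lambda>n. x (s n))"
        using disj sI injD[OF s(1)] unfolding disjoint_on_def by metis
      ultimately have "(\<lambda>n. f (x (s n))) \<longlonglongrightarrow> 0" using null by blast
      from eventually_happens[OF tendstoD[OF this e]] show False
        using big by (auto simp: not_le[symmetric])
    qed
    have trans: "le i k" if "le i j" "le j k" "i \<in> I" "j \<in> I" "k \<in> I" for i j k
      using dir that unfolding directed_set_def by meson
    have up: "\<exists>k\<in>I. le i k \<and> le j k" if "i \<in> I" "j \<in> I" for i j
      using dir that unfolding directed_set_def by meson
    \<comment> \<open>Every index \<open>a\<close> has a \<open>b\<close> not below it, and no index beyond \<open>b\<close> equals \<open>a\<close>.\<close>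
    have beyond: "\<exists>k\<in>I. \<forall>j\<in>I. le k j \<longrightarrow> j \<notin> T" if "finite T" "T \<subseteq> I" for T
      using that
    proof (induction T rule: finite_induct)
      case empty
      have "I \<noteq> {}" using dir by (simp add: directed_set_def)
      then show ?case by blast
    next
      case (insert a T)
      then obtain k where k: "k \<in> I" "\<forall>j\<in>I. le k j \<longrightarrow> j \<notin> T" and a: "a \<in> I" by auto
      obtain b where b: "b \<in> I" "\<not> le b a" using nomax a by blast
      obtain c where c: "c \<in> I" "le k c" "le b c" using up k(1) b(1) by blast
      have "j \<notin> insert a T" if j: "j \<in> I" "le c j" for j
        using trans[OF c(2) j(2)] trans[OF c(3) j(2)] k b c(1) j(1) by auto
      then show ?case using c(1) by blast
    qed
    obtain k where "k \<in> I" "\<forall>j\<in>I. le k j \<longrightarrow> j \<notin> S"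
      using beyond[OF \<open>finite S\<close>] by (auto simp: S_def)
    then show "\<forall>\<^sub>F i in tails I le. dist (f (x i)) 0 < e"
      unfolding eventually_tails[OF dir] S_def by (auto simp: not_le)
  qed
  then show "f \<in> disjoint_dual" using f by (simp add: disjoint_dual_def)
qed

theorem theorem2p7:
  fixes f :: "'a::banach_lattice \<Rightarrow> real"
  assumes "f \<in> order_cont_dual"
  shows
    "(f \<in> uo_dual \<longleftrightarrow>
       (\<forall>x :: nat \<Rightarrow> 'a. bounded (range x) \<longrightarrow> uo_null x sequentially \<longrightarrow>
          (\<lambda>n. f (x n)) \<longlonglongrightarrow> 0)) \<and>
     (f \<in> uo_dual \<longleftrightarrow> f \<in> uaw_dual) \<and>
     (f \<in> uo_dual \<longleftrightarrow>
       (\<forall>x :: nat \<Rightarrow> 'a. bounded (range x) \<longrightarrow> uaw_null x sequentially \<longrightarrow>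
          (\<lambda>n. f (x n)) \<longlonglongrightarrow> 0)) \<and>
     (f \<in> uo_dual \<longleftrightarrow> f \<in> disjoint_dual) \<and>
     (f \<in> uo_dual \<longleftrightarrow>
       (\<forall>x :: nat \<Rightarrow> 'a. bounded (range x) \<longrightarrow> disjoint_on UNIV x \<longrightarrow>
          (\<lambda>n. f (x n)) \<longlonglongrightarrow> 0)) \<and>
     (f \<in> uo_dual \<longleftrightarrow>
       (\<forall>g :: nat \<Rightarrow> 'a \<Rightarrow> real.
          range g \<subseteq> dual_interval (\<lambda>_. 0) (dual_abs f) \<longrightarrow> dual_disjoint_seq g \<longrightarrow>
          (\<lambda>n. onorm (g n)) \<longlonglongrightarrow> 0)) \<and>
     (order_continuous_norm TYPE('a) \<longrightarrow>
       (f \<in> uo_dual \<longleftrightarrow> f \<in> un_dual) \<and>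
       (f \<in> uo_dual \<longleftrightarrow>
         (\<forall>x :: nat \<Rightarrow> 'a. bounded (range x) \<longrightarrow> un_null x sequentially \<longrightarrow>
            (\<lambda>n. f (x n)) \<longlonglongrightarrow> 0)))"
proof -
  have f: "bounded_linear f" by (rule order_cont_imp_bounded_linear[OF assms])
  let ?seq = "\<lambda>null :: (nat \<Rightarrow> 'a) \<Rightarrow> bool.
    \<forall>x. bounded (range x) \<longrightarrow> null x \<longrightarrow> (\<lambda>n. f (x n)) \<longlonglongrightarrow> 0"
  let ?T = "uniformly_truncates (dual_abs f)"
  let ?uo = "?seq (\<lambda>x. uo_null x sequentially)" and ?uaw = "?seq (\<lambda>x. uaw_null x sequentially)"
    and ?un = "?seq (\<lambda>x. un_null x sequentially)" and ?disj = "?seq (disjoint_on UNIV)"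
    and ?dual = "\<forall>g :: nat \<Rightarrow> 'a \<Rightarrow> real.
      range g \<subseteq> dual_interval (\<lambda>_. 0) (dual_abs f) \<longrightarrow> dual_disjoint_seq g \<longrightarrow>
      (\<lambda>n. onorm (g n)) \<longlonglongrightarrow> 0"
  have ev_bdd: "\<exists>M. \<forall>\<^sub>F i in tails I le. norm (x i) \<le> M"
    if dir: "directed_set I le" and bdd: "bounded (x ` I)" for I le and x :: "'a net_index \<Rightarrow> 'a"
  proof -
    obtain M where "\<forall>i\<in>I. norm (x i) \<le> M" using bdd by (auto simp: bounded_iff)
    moreover obtain i where "i \<in> I" using dir by (auto simp: directed_set_def)
    ultimately show ?thesis unfolding eventually_tails[OF dir] by blast
  qed
  have uaw_lim: "((\<lambda>i. f (x i)) \<longlongrightarrow> 0) (tails I le)"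
    if "?T" "directed_set I le" "bounded (x ` I)" "uaw_null x (tails I le)"
    for I le and x :: "'a net_index \<Rightarrow> 'a"
    using ev_bdd[OF that(2,3)] uaw_null_imp_null[OF f that(1) _ that(4)] by blast
  have uo_lim: "((\<lambda>i. f (x i)) \<longlongrightarrow> 0) (tails I le)"
    if "?T" "directed_set I le" "bounded (x ` I)" "uo_null x (tails I le)"
    for I le and x :: "'a net_index \<Rightarrow> 'a"
    using ev_bdd[OF that(2,3)] uo_null_imp_null[OF assms that(1,2) _ that(4)] by blast

  have T_uo_dual: "?T \<Longrightarrow> f \<in> uo_dual"
    using uo_lim bounded_linear.linear[OF f] by (simp add: uo_dual_def)
  have T_uaw_dual: "?T \<Longrightarrow> f \<in> uaw_dual"
    using uaw_lim f by (simp add: uaw_dual_def)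
  have T_un_dual: "?T \<Longrightarrow> f \<in> un_dual"
    using uaw_lim f by (simp add: un_dual_def un_null_imp_uaw_null)
  have T_dual: "?T \<Longrightarrow> ?dual"
    using disjoint_functionals_norm_null[OF bounded_linear_dual_abs[OF f] nonneg_dual_abs[OF f]]
    by blast

  have nets: "(\<lambda>n. f (x n)) \<longlonglongrightarrow> 0"
    if "bounded (range x)" "f \<in> uo_dual \<and> uo_null x sequentially \<or>
      f \<in> un_dual \<and> un_null x sequentially \<or> f \<in> uaw_dual \<and> uaw_null x sequentially"
    for x :: "nat \<Rightarrow> 'a"
    using uo_un_uaw_dual_any_index[OF directed_set_nat that(1), unfolded tails_nat, OF that(2)] .
  have uo: "f \<in> uo_dual \<Longrightarrow> ?uo" and uaw: "f \<in> uaw_dual \<Longrightarrow> ?uaw" and un: "f \<in> un_dual \<Longrightarrow> ?un"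
    using nets by blast+

  have uo_disj: "?uo \<Longrightarrow> ?disj" and uaw_disj: "?uaw \<Longrightarrow> ?disj"
    using disjoint_seq_uo_null disjoint_seq_uaw_null by blast+
  have un_disj: "?un \<Longrightarrow> ?disj" if "order_continuous_norm TYPE('a)"
    using disjoint_seq_uo_null uo_null_imp_un_null[OF that] by blast
  have dual_disj: "?dual \<Longrightarrow> ?disj"
    using null_on_disjoint_if_disjoint_functionals_null[OF f] by blast
  have disj_T: "?disj \<Longrightarrow> ?T" using truncates_if_null_on_disjoint[OF f] by blast
  have disj_dual: "f \<in> disjoint_dual \<longleftrightarrow> ?disj" by (rule disjoint_dual_iff_sequences[OF f])

  have "f \<in> uo_dual \<longleftrightarrow> ?T" "?uo \<longleftrightarrow> ?T" "f \<in> uaw_dual \<longleftrightarrow> ?T" "?uaw \<longleftrightarrow> ?T" "?disj \<longleftrightarrow> ?T" "?dual \<longleftrightarrow> ?T"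
    using T_uo_dual T_uaw_dual T_dual uo uaw uo_disj uaw_disj dual_disj disj_T by argo+
  moreover have "f \<in> un_dual \<longleftrightarrow> ?T" "?un \<longleftrightarrow> ?T" if "order_continuous_norm TYPE('a)"
    using T_un_dual un un_disj[OF that] disj_T by argo+
  ultimately show ?thesis using disj_dual by simp
qed

end
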